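(* (i) For every Delaunay triangulation $T$ of a closed connected surface in which every vertex has degree greater than $5$, the dual Voronoi diagram, viewed as a graph $G=(V,E)$, satisfies $$\max_{\emptyset\ne\Omega\subsetneqq V}\frac{|E(\Omega)|}{|\Omega|}<\frac{|E|}{|V|}.\qquad (\mathrm{A})$$ (ii) In contrast, the condition $$\frac{|F_I|}{|I|}>\frac{|F|}{|V_T|}\quad\text{for every nonempty proper subset } I\subsetneqq V_T \qquad (\mathrm{B})$$ on the triangulation $T$ itself, where $V_T$ and $F$ are the sets of vertices and triangles of $T$, does not necessarily hold: there exist Delaunay triangulations of closed connected surfaces with all vertex degrees greater than $5$ for which (B) fails. (iii) If $T$ is a $6$-regular Delaunay triangulation of a closed connected surface (every vertex has degree $6$), then both (B) holds for $T$ and (A) holds for its dual Voronoi diagram.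
   Context: A Delaunay triangulation of a closed surface equipped with a metric is a finite geodesic triangulation whose triangles have empty circumscribed discs (no vertex of the triangulation in the interior); the dual Voronoi diagram is the dual cell decomposition, whose graph $G=(V,E)$ has one vertex for each triangle of $T$ and one edge for each edge of $T$, joining the two triangles sharing that edge. Conditions (A) and (B) only involve the combinatorial structure. For $\Omega\subseteq V$, $E(\Omega)$ is the set of edges of $G$ with both endpoints in $\Omega$. For $I\subseteq V_T$, $F_I$ is the set of all triangles of $T$ having a vertex in $I$. $|\cdot|$ denotes cardinality. Condition (A) is the condition for the existence of weights of constant Lin-Lu-Yau curvature, and condition (B) is Luo's condition for the existence of a piecewise linear metric of constant discrete Gaussian curvature; (A) is said to be less restrictive than (B) in the dual sense, meaning (i)–(iii). *)

theory Defs
  imports "HOL-Analysis.Analysis"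
begin

section \<open>Closed connected surfaces with a metric\<close>

definition closed_connected_surface :: "'a topology \<Rightarrow> bool" where
  "closed_connected_surface X \<longleftrightarrow>
     topspace X \<noteq> {} \<and> compact_space X \<and> connected_space X \<and> Hausdorff_space X \<and>
     (\<forall>x\<in>topspace X. \<exists>U V. openin X U \<and> x \<in> U \<and> open (V :: (real^2) set) \<and>
        subtopology X U homeomorphic_space top_of_set V)"

text \<open>Surface metrics (Riemannian, piecewise flat, ...) are intrinsic: the distance is the
  infimum of the lengths of the joining curves. On a compact space this infimum is attained
  (Hopf-Rinow), so that any two points are joined by a shortest curve.\<close>

definition intrinsic_metric :: "'a metric \<Rightarrow> bool" where
  "intrinsic_metric m \<longleftrightarrow>
     (\<forall>x\<in>mspace m. \<forall>y\<in>mspace m. \<exists>\<gamma>.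
        \<gamma> 0 = x \<and> \<gamma> (mdist m x y) = y \<and>
        (\<forall>t\<in>{0..mdist m x y}. \<gamma> t \<in> mspace m) \<and>
        (\<forall>s\<in>{0..mdist m x y}. \<forall>t\<in>{0..mdist m x y}. mdist m (\<gamma> s) (\<gamma> t) = \<bar>s - t\<bar>))"

definition closed_metric_surface :: "'a metric \<Rightarrow> bool" where
  "closed_metric_surface m \<longleftrightarrow>
     closed_connected_surface (mtopology_of m) \<and> intrinsic_metric m"

text \<open>Geodesics in the local sense, parametrized on the unit interval with constant speed \<open>L\<close>.\<close>

definition geodesic :: "'a metric \<Rightarrow> (real \<Rightarrow> 'a) \<Rightarrow> bool" where
  "geodesic m \<gamma> \<longleftrightarrow>
     (\<forall>t\<in>{0..1}. \<gamma> t \<in> mspace m) \<and>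
     (\<exists>L>0. \<forall>t\<in>{0..1}. \<exists>\<epsilon>>0. \<forall>s\<in>{0..1}. \<forall>s'\<in>{0..1}.
        \<bar>s - t\<bar> < \<epsilon> \<and> \<bar>s' - t\<bar> < \<epsilon> \<longrightarrow> mdist m (\<gamma> s) (\<gamma> s') = L * \<bar>s - s'\<bar>)"

section \<open>Triangulations\<close>

text \<open>The standard triangle in barycentric coordinates; \<open>open_face A\<close> is the relatively open face
  spanned by the corners \<open>i \<in> A\<close>.\<close>

definition std_triangle :: "(real^3) set" where
  "std_triangle = {b. (\<forall>i. 0 \<le> b $ i) \<and> (\<Sum>i\<in>UNIV. b $ i) = 1}"

definition corner :: "3 \<Rightarrow> real^3" where
  "corner i = axis i 1"

definition open_face :: "3 set \<Rightarrow> (real^3) set" where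
  "open_face A = {b\<in>std_triangle. {i. 0 < b $ i} = A}"

definition closed_face :: "3 set \<Rightarrow> (real^3) set" where
  "closed_face A = {b\<in>std_triangle. {i. 0 < b $ i} \<subseteq> A}"

definition open_side :: "3 \<Rightarrow> (real^3) set" where
  "open_side i = open_face (- {i})"

text \<open>A triangulation is given by the finite set \<open>T\<close> of the characteristic maps of its triangles,
  and a triangle of the triangulation is identified with its characteristic map. The edges are
  the images of the open sides, as sets of points of the surface.\<close>

type_synonym 'a triangulation = "(real^3 \<Rightarrow> 'a) set"

definition verts :: "'a triangulation \<Rightarrow> 'a set" where
  "verts T = {\<phi> (corner i) |\<phi> i. \<phi> \<in> T}"

definition edges :: "'a triangulation \<Rightarrow> 'a set set" where
  "edges T = {\<phi> ` open_side i |\<phi> i. \<phi> \<in> T}"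

text \<open>The open vertices, edges and triangles partition the space, and each edge is obtained by
  gluing a pair of sides. As usual for Delaunay triangulations of surfaces, a triangle may be
  glued to itself, and two triangles may share several edges or vertices; triangulations in the
  narrow sense of simplicial complexes satisfy in addition \<open>simplicial\<close> below.\<close>

definition triangulation :: "'a topology \<Rightarrow> 'a triangulation \<Rightarrow> bool" where
  "triangulation X T \<longleftrightarrow>
     finite T \<and>
     (\<forall>\<phi>\<in>T. continuous_map (top_of_set std_triangle) X \<phi> \<and> (\<forall>A. inj_on \<phi> (open_face A))) \<and>
     (\<Union>\<phi>\<in>T. \<phi> ` std_triangle) = topspace X \<and>
     (\<forall>\<phi>\<in>T. \<forall>\<psi>\<in>T. \<forall>A B. \<phi> ` open_face A \<inter> \<psi> ` open_face B \<noteq> {} \<longrightarrow>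
        card A = card B \<and> \<phi> ` open_face A = \<psi> ` open_face B) \<and>
     (\<forall>\<phi>\<in>T. \<forall>\<psi>\<in>T. \<phi> ` open_face UNIV \<inter> \<psi> ` open_face UNIV \<noteq> {} \<longrightarrow> \<phi> = \<psi>) \<and>
     (\<forall>e\<in>edges T. card {(\<phi>, i). \<phi> \<in> T \<and> \<phi> ` open_side i = e} = 2)"

text \<open>Triangles are embedded, and two distinct ones are disjoint or meet in exactly one common
  vertex or one common edge.\<close>

definition simplicial :: "'a triangulation \<Rightarrow> bool" where
  "simplicial T \<longleftrightarrow>
     (\<forall>\<phi>\<in>T. inj_on \<phi> std_triangle) \<and>
     (\<forall>\<phi>\<in>T. \<forall>\<psi>\<in>T. \<phi> \<noteq> \<psi> \<longrightarrow>
        (\<exists>A B. \<phi> ` std_triangle \<inter> \<psi> ` std_triangle = \<phi> ` closed_face A \<and>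
               \<phi> ` closed_face A = \<psi> ` closed_face B))"

definition geodesic_triangulation :: "'a metric \<Rightarrow> 'a triangulation \<Rightarrow> bool" where
  "geodesic_triangulation m T \<longleftrightarrow>
     triangulation (mtopology_of m) T \<and>
     (\<forall>\<phi>\<in>T. \<forall>i j. i \<noteq> j \<longrightarrow>
        geodesic m (\<lambda>t. \<phi> ((1 - t) *\<^sub>R corner i + t *\<^sub>R corner j)))"

text \<open>The disc with center \<open>c\<close> and radius \<open>r\<close> is circumscribed about a triangle if the three
  corners are at distance \<open>r\<close> from \<open>c\<close>; it is empty if no vertex of the triangulation is at
  distance less than \<open>r\<close>. An immersed empty circumscribed disc also gives such \<open>c\<close> and \<open>r\<close>:
  curves from \<open>c\<close> of length less than \<open>r\<close> lift to the interior of the disc.\<close>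

definition has_empty_circumdisc ::
  "'a metric \<Rightarrow> 'a triangulation \<Rightarrow> (real^3 \<Rightarrow> 'a) \<Rightarrow> bool" where
  "has_empty_circumdisc m T \<phi> \<longleftrightarrow>
     (\<exists>c\<in>mspace m. \<exists>r>0.
        (\<forall>i. mdist m c (\<phi> (corner i)) = r) \<and> verts T \<inter> {x\<in>mspace m. mdist m c x < r} = {})"

definition delaunay :: "'a metric \<Rightarrow> 'a triangulation \<Rightarrow> bool" where
  "delaunay m T \<longleftrightarrow>
     geodesic_triangulation m T \<and> (\<forall>\<phi>\<in>T. has_empty_circumdisc m T \<phi>)"

definition edge_ends :: "'a triangulation \<Rightarrow> 'a set \<Rightarrow> 'a set" where
  "edge_ends T e = {\<phi> (corner j) |\<phi> i j. \<phi> \<in> T \<and> \<phi> ` open_side i = e \<and> j \<noteq> i}"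

text \<open>As usual, an edge whose two ends coincide contributes two to the degree.\<close>

definition vdegree :: "'a triangulation \<Rightarrow> 'a \<Rightarrow> nat" where
  "vdegree T v = card {e\<in>edges T. v \<in> edge_ends T e} + card {e\<in>edges T. edge_ends T e = {v}}"

section \<open>The dual Voronoi diagram and the two conditions\<close>

text \<open>A graph consists of a set of vertices, a set of edges, and the map that sends an edge to the
  set of its endpoints.\<close>

definition dual_voronoi ::
  "'a triangulation \<Rightarrow> (real^3 \<Rightarrow> 'a) set \<times> 'a set set \<times> ('a set \<Rightarrow> (real^3 \<Rightarrow> 'a) set)" where
  "dual_voronoi T = (T, edges T, \<lambda>e. {\<phi>\<in>T. \<exists>i. \<phi> ` open_side i = e})"

definition edges_within :: "'e set \<Rightarrow> ('e \<Rightarrow> 'v set) \<Rightarrow> 'v set \<Rightarrow> 'e set" where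
  "edges_within E ends \<Omega> = {e\<in>E. ends e \<subseteq> \<Omega>}"

definition condition_A :: "'v set \<times> 'e set \<times> ('e \<Rightarrow> 'v set) \<Rightarrow> bool" where
  "condition_A G \<longleftrightarrow> (case G of (V, E, ends) \<Rightarrow>
     Max {real (card (edges_within E ends \<Omega>)) / real (card \<Omega>) |\<Omega>. \<Omega> \<noteq> {} \<and> \<Omega> \<subset> V}
       < real (card E) / real (card V))"

definition triangles_meeting :: "'a triangulation \<Rightarrow> 'a set \<Rightarrow> (real^3 \<Rightarrow> 'a) set" where
  "triangles_meeting T I = {\<phi>\<in>T. \<exists>i. \<phi> (corner i) \<in> I}"

definition condition_B :: "'a triangulation \<Rightarrow> bool" where
  "condition_B T \<longleftrightarrow> (\<forall>I. I \<noteq> {} \<and> I \<subset> verts T \<longrightarrow>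
     real (card (triangles_meeting T I)) / real (card I) > real (card T) / real (card (verts T)))"

end

theory Submission
  imports Defs "HOL-Complex_Analysis.Great_Picard"
begin

text \<open>
  Conditions (A) and (B) compare a part of the triangulation with the whole, and both reduce to
  double counting together with one fact about surfaces: the dual graph is connected
  (\<open>dual_connected\<close>). If no edge led from a set of triangles to its complement, then the two closed
  sets covered by them would meet in vertices only; but a vertex has a neighbourhood that stays
  connected when the vertex is removed, so near the vertex only one of the two sets occurs, and the
  surface would fall apart.

  For (A), count the sides of the triangles in \<open>\<Omega>\<close>: there are \<open>3 |\<Omega>|\<close> of them, every edge within
  \<open>\<Omega>\<close> uses up two, and at least one side is left over because some edge leaves \<open>\<Omega>\<close>. Hence
  \<open>|E(\<Omega>)| / |\<Omega>| < 3/2\<close>, while \<open>|E| / |V| = 3/2\<close>. For (B) in the 6-regular case, count corners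
  instead: the number of triangle corners at a vertex is its degree (\<open>card_corners_at\<close>), so that
  \<open>|F| / |V\<^sub>T| = 2\<close> and \<open>6 |I| < 3 |F\<^sub>I|\<close>, where strictness again comes from connectedness.

  A counterexample to (B) in higher genus has a dense part and a sparse part: a torus with 7
  vertices, all of degree 6, is joined to a surface triangulated with the complete graph on 13
  vertices by gluing along a triangle. The 4 torus vertices outside that triangle meet
  only 13 triangles, whereas the whole surface has 64 triangles on 17 vertices, and
  \<open>13/4 < 64/17\<close>.

  It remains to put a metric on this surface for which the triangulation is Delaunay. The vertices
  are placed at an orthonormal basis of \<open>\<real>\<^sup>1\<^sup>7\<close>, so that all triangles are equilateral, and the polyhedron
  they form gets the metric that measures the lengths of paths within it. Shortest paths exist by
  compactness, and on each triangle the metric is the Euclidean one, so that edges are geodesics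
  and the topology is that of the polyhedron. The length metric dominates the Euclidean
  distance of \<open>\<real>\<^sup>1\<^sup>7\<close>, in which the barycentre of a triangle is closer to the corners of this triangle than
  to any other vertex; this yields the empty circumscribed discs. Finally, the polyhedron is a
  surface because every vertex link is a cycle: polar coordinates, with the link as the circle of
  directions, identify the open star of a vertex with a disc.
\<close>

section \<open>The standard triangle and its faces\<close>

lemma corner_nth [simp]: "corner i $ j = (if i = j then 1 else 0)"
  by (auto simp: corner_def axis_def)

lemma corner_in_std_triangle [simp]: "corner i \<in> std_triangle"
  by (auto simp: std_triangle_def)

lemma open_face_subset: "open_face A \<subseteq> std_triangle"
  by (auto simp: open_face_def)

lemma std_triangle_cases:
  assumes "b \<in> std_triangle"
  obtains A where "A \<noteq> {}" "b \<in> open_face A"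
proof
  show "b \<in> open_face {i. 0 < b $ i}"
    using assms by (simp add: open_face_def)
  show "{i. 0 < b $ i} \<noteq> {}"
  proof
    assume "{i. 0 < b $ i} = {}"
    then have "b $ i \<le> 0" for i by (auto simp: not_less)
    then have "(\<Sum>i\<in>UNIV. b $ i) \<le> 0" by (simp add: sum_nonpos)
    then show False using assms by (simp add: std_triangle_def)
  qed
qed

lemma open_face_singleton: "open_face {i} = {corner i}"
proof
  show "open_face {i} \<subseteq> {corner i}"
  proof
    fix b assume b: "b \<in> open_face {i}"
    have z: "b $ j = 0" if "j \<noteq> i" for j
      using b that by (force simp: open_face_def std_triangle_def order.order_iff_strict)
    have "(\<Sum>j\<in>UNIV. b $ j) = (\<Sum>j\<in>{i}. b $ j)"
      by (rule sum.mono_neutral_right) (use z in auto)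
    then have "b $ i = 1"
      using b by (simp add: open_face_def std_triangle_def)
    with z show "b \<in> {corner i}" by (auto simp: vec_eq_iff)
  qed
  show "{corner i} \<subseteq> open_face {i}"
    by (auto simp: open_face_def split: if_splits)
qed

lemma corner_in_open_face: "corner i \<in> open_face {i}"
  by (simp add: open_face_singleton)

lemma convex_std_triangle: "convex std_triangle"
  by (auto simp: std_triangle_def convex_def sum.distrib simp flip: sum_distrib_left)

lemma compact_closed_face: "compact (closed_face A)"
proof -
  have eq: "closed_face A = {b. (\<forall>i. 0 \<le> b $ i)} \<inter> {b. (\<Sum>i\<in>UNIV. b $ i) = 1} \<inter> (\<Inter>i\<in>-A. {b. b $ i = 0})"
    by (auto simp: closed_face_def std_triangle_def order.order_iff_strict subset_iff)
  have "closed (closed_face A)"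
    unfolding eq
    by (intro closed_Int closed_INT ballI closed_Collect_all closed_Collect_le closed_Collect_eq)
       (auto intro!: continuous_intros)
  moreover have "bounded (closed_face A)"
    unfolding bounded_iff
  proof (intro exI ballI)
    fix b assume "b \<in> closed_face A"
    then have "(\<Sum>i\<in>UNIV. \<bar>b $ i\<bar>) = 1" by (simp add: closed_face_def std_triangle_def)
    then show "norm b \<le> 1" using norm_le_l1_cart[of b] by simp
  qed
  ultimately show ?thesis by (simp add: compact_eq_bounded_closed)
qed

lemma std_triangle_eq: "std_triangle = closed_face UNIV"
  by (auto simp: closed_face_def)

lemma compact_std_triangle: "compact std_triangle"
  by (simp add: std_triangle_eq compact_closed_face)

text \<open>Moving a point of a closed face slightly towards the barycentre of that face makes all
  the barycentric coordinates of the face positive.\<close>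

lemma closed_face_subset_closure: 
  assumes "A \<noteq> {}"
  shows "closed_face A \<subseteq> closure (open_face A)"
proof
  fix b assume b: "b \<in> closed_face A"
  define c :: "real^3" where "c = (\<chi> i. if i \<in> A then 1 / card A else 0)"
  have cA: "card A > 0" using assms by (simp add: card_gt_0_iff)
  have c: "c \<in> std_triangle"
    using cA by (auto simp: std_triangle_def c_def simp flip: sum.inter_filter)
  let ?x = "\<lambda>n. (1 - inverse (real (Suc n))) *\<^sub>R b + inverse (real (Suc n)) *\<^sub>R c"
  have "?x n \<in> open_face A" for n
  proof -
    have "?x n \<in> std_triangle"
      using b c by (intro convexD_alt[OF convex_std_triangle]) (auto simp: closed_face_def field_simps)
    moreover have "0 < ?x n $ i \<longleftrightarrow> i \<in> A" for i
    proof (cases "i \<in> A")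
      case True
      have "0 \<le> (1 - inverse (real (Suc n))) * b $ i"
        using b by (intro mult_nonneg_nonneg) (auto simp: closed_face_def std_triangle_def field_simps)
      moreover have "0 < inverse (real (Suc n)) * c $ i" using True cA by (simp add: c_def)
      ultimately show ?thesis using True by (simp add: add_nonneg_pos)
    next
      case False
      then have "b $ i = 0" using b by (force simp: closed_face_def std_triangle_def order.order_iff_strict)
      then show ?thesis using False by (simp add: c_def)
    qed
    ultimately show ?thesis by (auto simp: open_face_def)
  qed
  moreover have "?x \<longlonglongrightarrow> (1 - 0) *\<^sub>R b + 0 *\<^sub>R c"
    by (intro tendsto_intros LIMSEQ_inverse_real_of_nat)
  ultimately show "b \<in> closure (open_face A)"
    unfolding closure_sequential by (metis (no_types, lifting) diff_zero scaleR_one scaleR_zero_left add.right_neutral)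
qed

lemma card_side: "card (- {i :: 3}) = 2"
  by (simp add: Compl_eq_Diff_UNIV)

lemma closed_side_eq: "closed_face (- {i}) = open_side i \<union> corner ` (- {i})"
proof
  show "closed_face (- {i}) \<subseteq> open_side i \<union> corner ` (- {i})"
  proof
    fix b assume b: "b \<in> closed_face (- {i})"
    then obtain A where A: "A \<noteq> {}" "b \<in> open_face A"
      using std_triangle_cases by (auto simp: closed_face_def)
    then have sub: "A \<subseteq> - {i}" using b by (auto simp: open_face_def closed_face_def)
    show "b \<in> open_side i \<union> corner ` (- {i})"
    proof (cases "A = - {i}")
      case True then show ?thesis using A by (simp add: open_side_def)
    next
      case False
      then have "card A < card (- {i})" using sub by (simp add: psubset_card_mono psubset_eq)
      also have "card (- {i}) = 2" by (rule card_side)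
      finally have "card A = 1" using A(1) by (metis One_nat_def card_gt_0_iff finite less_2_cases_iff less_irrefl)
      then obtain j where "A = {j}" by (auto simp: card_1_singleton_iff)
      then show ?thesis using A sub by (auto simp: open_face_singleton)
    qed
  qed
  show "open_side i \<union> corner ` (- {i}) \<subseteq> closed_face (- {i})"
    by (auto simp: open_side_def open_face_def closed_face_def split: if_splits)
qed

lemma open_face_nonempty: "A \<noteq> {} \<Longrightarrow> open_face A \<noteq> {}"
proof -
  assume A: "A \<noteq> {}"
  then obtain i where "i \<in> A" by auto
  then have "corner i \<in> closed_face A" by (auto simp: closed_face_def split: if_splits)
  then show ?thesis using closed_face_subset_closure[OF A] by auto
qed

lemma open_side_nonempty: "open_side i \<noteq> {}"
  unfolding open_side_def using card_side[of i] by (intro open_face_nonempty) auto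

section \<open>Incidences in a triangulation\<close>

definition sides_on :: "'a triangulation \<Rightarrow> 'a set \<Rightarrow> ((real^3 \<Rightarrow> 'a) \<times> 3) set" where
  "sides_on T e = {(\<phi>, i). \<phi> \<in> T \<and> \<phi> ` open_side i = e}"

definition corners_at :: "'a triangulation \<Rightarrow> 'a \<Rightarrow> ((real^3 \<Rightarrow> 'a) \<times> 3) set" where
  "corners_at T v = {(\<phi>, j). \<phi> \<in> T \<and> \<phi> (corner j) = v}"

context
  fixes X :: "'a topology" and T :: "'a triangulation"
  assumes tri: "triangulation X T"
begin

lemma triangulation_finite: "finite T"
  using tri by (simp add: triangulation_def)

lemma triangulation_continuous: "\<phi> \<in> T \<Longrightarrow> continuous_map (top_of_set std_triangle) X \<phi>"
  using tri by (simp add: triangulation_def)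

lemma triangulation_cover: "(\<Union>\<phi>\<in>T. \<phi> ` std_triangle) = topspace X"
  using tri by (simp add: triangulation_def)

lemma triangulation_faces:
  assumes "\<phi> \<in> T" "\<psi> \<in> T" "b \<in> open_face A" "c \<in> open_face B" "\<phi> b = \<psi> c"
  shows "card A = card B" "\<phi> ` open_face A = \<psi> ` open_face B"
proof -
  have "\<phi> ` open_face A \<inter> \<psi> ` open_face B \<noteq> {}"
    using assms by (metis IntI empty_iff imageI)
  then show "card A = card B" "\<phi> ` open_face A = \<psi> ` open_face B"
    using tri assms(1,2) unfolding triangulation_def by meson+
qed

lemma triangulation_interior:
  assumes "\<phi> \<in> T" "\<psi> \<in> T" "b \<in> open_face UNIV" "c \<in> open_face UNIV" "\<phi> b = \<psi> c"
  shows "\<phi> = \<psi>"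
proof -
  have "\<phi> ` open_face UNIV \<inter> \<psi> ` open_face UNIV \<noteq> {}"
    using assms by (metis IntI empty_iff imageI)
  then show ?thesis
    using tri assms(1,2) unfolding triangulation_def by blast
qed

lemma card_sides_on: "e \<in> edges T \<Longrightarrow> card (sides_on T e) = 2"
  using tri by (auto simp: triangulation_def sides_on_def)

lemma edges_eq_image: "edges T = (\<lambda>(\<phi>, i). \<phi> ` open_side i) ` (T \<times> UNIV)"
  by (force simp: edges_def)

lemma finite_edges: "finite (edges T)"
  unfolding edges_eq_image using triangulation_finite by simp

lemma verts_eq_image: "verts T = (\<lambda>(\<phi>, i). \<phi> (corner i)) ` (T \<times> UNIV)"
  by (force simp: verts_def)

lemma finite_verts: "finite (verts T)"
  unfolding verts_eq_image using triangulation_finite by simp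

lemma sum_over_sides:
  fixes f :: "(real^3 \<Rightarrow> 'a) \<times> 3 \<Rightarrow> nat"
  shows "(\<Sum>p\<in>T \<times> UNIV. f p) = (\<Sum>e\<in>edges T. \<Sum>p\<in>sides_on T e. f p)"
proof -
  have eq: "{p \<in> T \<times> UNIV. (\<lambda>(\<phi>, i). \<phi> ` open_side i) p = e} = sides_on T e" for e
    by (auto simp: sides_on_def)
  show ?thesis
    using sum.group[of "T \<times> (UNIV :: 3 set)" "edges T" "\<lambda>(\<phi>, i). \<phi> ` open_side i" f]
      triangulation_finite finite_edges by (simp add: edges_eq_image eq)
qed

text \<open>Every triangle has three sides and every edge comes from two of them.\<close>

lemma three_triangles_eq_two_edges: "3 * card T = 2 * card (edges T)"
  using sum_over_sides[of "\<lambda>_. 1"] by (simp add: card_sides_on card_cartesian_product mult.commute)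

lemma three_triangles_eq_corners: "3 * card T = (\<Sum>v\<in>verts T. card (corners_at T v))"
proof -
  have eq: "{p \<in> T \<times> UNIV. (\<lambda>(\<phi>, i). \<phi> (corner i)) p = v} = corners_at T v" for v
    by (auto simp: corners_at_def)
  show ?thesis
    using sum.group[of "T \<times> (UNIV :: 3 set)" "verts T" "\<lambda>(\<phi>, i). \<phi> (corner i)" "\<lambda>_. 1::nat"]
      triangulation_finite finite_verts 
    by (simp add: verts_eq_image eq card_cartesian_product mult.commute)
qed

end

section \<open>Edges and their ends\<close>

context
  fixes X :: "'a topology" and T :: "'a triangulation"
  assumes tri: "triangulation X T" and haus: "Hausdorff_space X"
begin

text \<open>The two ends of an edge are the points of its closure that are not on it; hence they do not
  depend on the side that represents the edge.\<close>

lemma side_ends_eq_frontier: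
  assumes "\<phi> \<in> T"
  shows "\<phi> ` corner ` (- {i}) = X closure_of (\<phi> ` open_side i) - \<phi> ` open_side i"
proof -
  note cont = triangulation_continuous[OF tri assms]
  have ne: "- {i} \<noteq> {}" using card_side[of i] by auto
  have sub: "closed_face (- {i}) \<subseteq> std_triangle" by (auto simp: closed_face_def)
  have "compactin X (\<phi> ` closed_face (- {i}))"
    by (rule image_compactin[OF _ cont]) (simp add: compactin_subtopology sub compact_closed_face)
  then have "closedin X (\<phi> ` closed_face (- {i}))"
    using haus compactin_imp_closedin by blast
  moreover have "\<phi> ` open_side i \<subseteq> \<phi> ` closed_face (- {i})"
    unfolding closed_side_eq by blast
  ultimately have 1: "X closure_of (\<phi> ` open_side i) \<subseteq> \<phi> ` closed_face (- {i})"
    by (simp add: closure_of_minimal)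
  have "\<phi> ` closed_face (- {i}) \<subseteq> \<phi> ` (top_of_set std_triangle closure_of open_side i)"
    using closed_face_subset_closure[OF ne] sub
    by (auto simp: open_side_def closure_of_subtopology Int_absorb1[OF open_face_subset] intro!: imageI)
  also have "\<dots> \<subseteq> X closure_of (\<phi> ` open_side i)"
    using continuous_map_image_closure_subset[OF cont] .
  finally have cl: "X closure_of (\<phi> ` open_side i) = \<phi> ` closed_face (- {i})"
    using 1 by blast
  have "\<phi> (corner j) \<notin> \<phi> ` open_side i" for j
  proof
    assume "\<phi> (corner j) \<in> \<phi> ` open_side i"
    then obtain b where "b \<in> open_face (- {i})" "\<phi> (corner j) = \<phi> b"
      by (auto simp: open_side_def)
    from triangulation_faces(1)[OF tri assms assms corner_in_open_face this]
    show False by (simp add: card_side)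
  qed
  then show ?thesis unfolding cl closed_side_eq by auto
qed

lemma side_ends_cong:
  assumes "\<phi> \<in> T" "\<psi> \<in> T" "\<phi> ` open_side i = \<psi> ` open_side k"
  shows "\<phi> ` corner ` (- {i}) = \<psi> ` corner ` (- {k})"
  using side_ends_eq_frontier[OF assms(1)] side_ends_eq_frontier[OF assms(2)] assms(3) by simp

lemma edge_ends_eq:
  assumes "(\<phi>, i) \<in> sides_on T e"
  shows "edge_ends T e = \<phi> ` corner ` (- {i})"
proof -
  have "edge_ends T e = (\<Union>(\<psi>, k)\<in>sides_on T e. \<psi> ` corner ` (- {k}))"
    unfolding edge_ends_def sides_on_def by auto
  also have "\<dots> = (\<Union>(\<psi>, k)\<in>sides_on T e. \<phi> ` corner ` (- {i}))"
  proof (intro SUP_cong refl, clarify)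
    fix \<psi> k assume "(\<psi>, k) \<in> sides_on T e"
    with assms have "\<phi> \<in> T" "\<psi> \<in> T" "\<phi> ` open_side i = \<psi> ` open_side k"
      by (auto simp: sides_on_def)
    from side_ends_cong[OF this] show "\<psi> ` corner ` (- {k}) = \<phi> ` corner ` (- {i})" ..
  qed
  also have "\<dots> = \<phi> ` corner ` (- {i})" using assms by auto
  finally show ?thesis .
qed

text \<open>A flag consists of a side of a triangle and one of the two ends of that side. If both ends of an
  edge are at \<open>v\<close>, then each of its sides has two flags at \<open>v\<close>, in accordance with its
  contribution to the degree.\<close>

lemma card_flags_at:
  assumes "(\<phi>, i) \<in> sides_on T e"
  shows "card {j. j \<noteq> i \<and> \<phi> (corner j) = v} =
         of_bool (v \<in> edge_ends T e) + of_bool (edge_ends T e = {v})"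
proof -
  obtain j k where jk: "- {i} = {j, k}" "j \<noteq> k"
    using card_side[of i] by (meson card_2_iff)
  have ends: "edge_ends T e = {\<phi> (corner j), \<phi> (corner k)}"
    by (simp add: edge_ends_eq[OF assms] jk)
  have "{j. j \<noteq> i \<and> \<phi> (corner j) = v} = {x \<in> - {i}. \<phi> (corner x) = v}" by auto
  also have "\<dots> = (if \<phi> (corner j) = v then {j} else {}) \<union> (if \<phi> (corner k) = v then {k} else {})"
    unfolding jk by auto
  finally show ?thesis unfolding ends using jk(2) by auto
qed

text \<open>At a triangle corner two sides end, and each edge is represented by two sides: counting the
  flags at a vertex in both ways identifies its degree with the number of corners there.\<close>

lemma card_corners_at: "card (corners_at T v) = vdegree T v"
proof -
  let ?n = "\<lambda>(\<phi>, i). card {j. j \<noteq> i \<and> \<phi> (corner j) = v}"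
  note fin = triangulation_finite[OF tri] finite_edges[OF tri]
  have "(\<Sum>p\<in>T \<times> UNIV. ?n p) = (\<Sum>\<phi>\<in>T. \<Sum>i\<in>UNIV. \<Sum>j\<in>UNIV. of_bool (j \<noteq> i \<and> \<phi> (corner j) = v))"
    by (simp add: sum.cartesian_product[symmetric])
  also have "\<dots> = (\<Sum>\<phi>\<in>T. \<Sum>j\<in>UNIV. \<Sum>i\<in>UNIV. of_bool (j \<noteq> i \<and> \<phi> (corner j) = v))"
    by (intro sum.cong refl sum.swap)
  also have "\<dots> = (\<Sum>\<phi>\<in>T. \<Sum>j\<in>UNIV. 2 * of_bool (\<phi> (corner j) = v))"
  proof (intro sum.cong refl)
    fix \<phi> and j :: 3
    have "{i. j \<noteq> i} = - {j}" by auto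
    then show "(\<Sum>i\<in>UNIV. of_bool (j \<noteq> i \<and> \<phi> (corner j) = v)) = (2 * of_bool (\<phi> (corner j) = v) :: nat)"
      using card_side[of j] by simp
  qed
  also have "\<dots> = 2 * (\<Sum>(\<phi>, j)\<in>T \<times> UNIV. of_bool (\<phi> (corner j) = v))"
    by (simp only: sum_distrib_left[symmetric] sum.cartesian_product)
  also have "(\<Sum>(\<phi>, j)\<in>T \<times> UNIV. of_bool (\<phi> (corner j) = v)) = (\<Sum>p\<in>corners_at T v. 1 :: nat)"
    using fin by (intro sum.mono_neutral_cong_right) (auto simp: corners_at_def)
  finally have 1: "(\<Sum>p\<in>T \<times> UNIV. ?n p) = 2 * card (corners_at T v)" by simp
  have "(\<Sum>p\<in>T \<times> UNIV. ?n p) = (\<Sum>e\<in>edges T. \<Sum>p\<in>sides_on T e. ?n p)"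
    by (rule sum_over_sides[OF tri])
  also have "\<dots> = (\<Sum>e\<in>edges T. \<Sum>p\<in>sides_on T e. of_bool (v \<in> edge_ends T e) + of_bool (edge_ends T e = {v}))"
    by (intro sum.cong refl) (auto simp: card_flags_at)
  also have "\<dots> = (\<Sum>e\<in>edges T. 2 * of_bool (v \<in> edge_ends T e) + 2 * of_bool (edge_ends T e = {v}))"
    by (intro sum.cong refl) (simp add: card_sides_on[OF tri])
  also have "\<dots> = 2 * vdegree T v"
    using fin by (simp add: sum.distrib vdegree_def Int_def flip: sum_distrib_left)
  finally show ?thesis using 1 by simp
qed

end

section \<open>The dual graph of a triangulated surface is connected\<close>

text \<open>If two closed sets cover a surface and meet in finitely many points only, then a small
  punctured disc around a common point is connected, so it lies in one of the two sets and is
  disjoint from the other. The last two hypotheses exclude this, as every point of either set is a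
  limit of points of that set outside \<open>W\<close>. Thus the two sets are disjoint, against connectedness.\<close>

lemma connected_minus_isolated_intersection:
  assumes surf: "closed_connected_surface X"
    and K: "closedin X K1" "closedin X K2" "K1 \<union> K2 = topspace X" "K1 \<noteq> {}" "K2 \<noteq> {}"
    and W: "finite W" "K1 \<inter> K2 \<subseteq> W"
    and dense: "\<And>x N. openin X N \<Longrightarrow> x \<in> N \<Longrightarrow> x \<in> K1 \<Longrightarrow> \<exists>y\<in>N. y \<in> K1 - W"
      "\<And>x N. openin X N \<Longrightarrow> x \<in> N \<Longrightarrow> x \<in> K2 \<Longrightarrow> \<exists>y\<in>N. y \<in> K2 - W"
  shows False
proof -
  have haus: "Hausdorff_space X" and conn: "connected_space X"
    using surf by (auto simp: closed_connected_surface_def)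
  have "K1 \<inter> K2 = {}"
  proof (rule ccontr)
    assume "K1 \<inter> K2 \<noteq> {}"
    then obtain v where v: "v \<in> K1" "v \<in> K2" by blast
    then have "v \<in> topspace X" using K(3) by blast
    then obtain U V where U: "openin X U" "v \<in> U" and V: "open (V :: (real^2) set)"
      and "subtopology X U homeomorphic_space top_of_set V"
      using surf by (auto simp: closed_connected_surface_def)
    then obtain f g where fg: "homeomorphic_maps (subtopology X U) (top_of_set V) f g"
      by (auto simp: homeomorphic_space_def)
    have UX: "U \<subseteq> topspace X" using U(1) by (rule openin_subset)
    have gf: "\<And>x. x \<in> U \<Longrightarrow> f x \<in> V \<and> g (f x) = x" and fg': "\<And>y. y \<in> V \<Longrightarrow> g y \<in> U \<and> f (g y) = y"
      using fg UX by (auto simp: homeomorphic_maps_def continuous_map_def Pi_iff Int_absorb1)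
    have gopen: "open_map (top_of_set V) (subtopology X U) g" and gcont: "continuous_map (top_of_set V) (subtopology X U) g"
      and fopen: "open_map (subtopology X U) (top_of_set V) f"
      using fg by (simp_all add: homeomorphic_maps_map homeomorphic_imp_open_map homeomorphic_imp_continuous_map)
    \<comment> \<open>The other exceptional points are removed from the chart, so that the punctured disc avoids
      \<open>W\<close>.\<close>
    define U' where "U' = U - (W - {v})"
    have "closedin X ((W - {v}) \<inter> topspace X)"
      using haus W(1) by (intro closedin_Hausdorff_finite) auto
    then have "openin X (U - ((W - {v}) \<inter> topspace X))" using U(1) openin_diff by blast
    also have "U - ((W - {v}) \<inter> topspace X) = U'" using UX by (auto simp: U'_def)
    finally have U': "openin (subtopology X U) U'" "v \<in> U'" "U' \<subseteq> U"
      using U by (auto simp: U'_def openin_open_subtopology)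
    then have "openin (top_of_set V) (f ` U')" using fopen by (auto simp: open_map_def)
    then have "open (f ` U')" using V by (simp add: openin_open_eq)
    then obtain r where r: "r > 0" "ball (f v) r \<subseteq> f ` U'"
      using U'(2) by (meson imageI openE)
    have BV: "ball (f v) r \<subseteq> V" using r(2) gf U'(3) by blast
    let ?N = "g ` ball (f v) r"
    have NU: "?N \<subseteq> U'" using r(2) gf U'(3) by force
    have "openin (subtopology X U) ?N"
      using gopen BV V by (auto simp: open_map_def openin_open_eq)
    then have Nop: "openin X ?N" using U(1) by (simp add: openin_open_subtopology)
    have vN: "v \<in> ?N" using r(1) gf U(2) by (metis centre_in_ball imageI)
    let ?P = "g ` (ball (f v) r - {f v})"
    have NP: "?P = ?N - {v}" 
      using BV fg' gf U(2) by auto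
    have "connected (ball (f v) r - {f v})"
      by (intro connected_punctured_ball) simp
    then have "connectedin (top_of_set V) (ball (f v) r - {f v})"
      using BV by (auto simp: connectedin_subtopology)
    then have "connectedin (subtopology X U) ?P"
      using gcont connectedin_continuous_map_image by blast
    then have cP: "connectedin X ?P" by (simp add: connectedin_subtopology)
    have PW: "?P \<inter> W = {}" using NU unfolding NP U'_def by blast
    have "?P \<inter> K1 = {} \<or> ?P \<inter> K2 = {}"
    proof (rule ccontr)
      assume "\<not> ?thesis"
      moreover have "?P \<subseteq> K1 \<union> K2" using cP K(3) by (simp add: connectedin_def)
      ultimately show False
        using cP K(1,2) PW W(2) unfolding connectedin_closedin by blast
    qed
    moreover have "\<exists>y\<in>?N. y \<in> K1 - W" using dense(1)[OF Nop vN v(1)] .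
    moreover have "\<exists>y\<in>?N. y \<in> K2 - W" using dense(2)[OF Nop vN v(2)] .
    moreover have "v \<in> W" using v W(2) by blast
    ultimately show False unfolding NP by blast
  qed
  then show False
    using conn K unfolding connected_space_closedin by (metis subset_refl)
qed

text \<open>The triangles in \<open>\<Omega>\<close> and the remaining ones cover two closed sets. A common point that is not a
  vertex lies in the interior of a common edge, since distinct open triangles are disjoint.\<close>

lemma dual_connected:
  assumes tri: "triangulation X T" and surf: "closed_connected_surface X"
    and Om: "\<Omega> \<noteq> {}" "\<Omega> \<subset> T"
  obtains \<phi> \<psi> i k where "\<phi> \<in> \<Omega>" "\<psi> \<in> T - \<Omega>" "\<phi> ` open_side i = \<psi> ` open_side k"
proof (rule ccontr)
  assume "\<not> thesis"
  then have nocross: "\<phi> ` open_side i \<noteq> \<psi> ` open_side k" if "\<phi> \<in> \<Omega>" "\<psi> \<in> T - \<Omega>" for \<phi> \<psi> i k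
    using that \<open>\<And>\<psi> \<phi> k i. \<lbrakk>\<phi> \<in> \<Omega>; \<psi> \<in> T - \<Omega>; \<phi> ` open_side i = \<psi> ` open_side k\<rbrakk> \<Longrightarrow> thesis\<close> by blast
  have haus: "Hausdorff_space X"
    using surf by (simp add: closed_connected_surface_def)
  let ?K = "\<lambda>\<Omega>. \<Union>\<phi>\<in>\<Omega>. \<phi> ` std_triangle"
  have closed: "closedin X (?K \<Omega>)" if sub: "\<Omega> \<subseteq> T" for \<Omega>
  proof (intro closedin_Union ballI, goal_cases)
    case 1 show ?case using finite_subset[OF sub triangulation_finite[OF tri]] by simp
  next
    case (2 S)
    then obtain \<phi> where \<phi>: "\<phi> \<in> T" "S = \<phi> ` std_triangle" using sub by blast
    then have "compactin X S"
      using image_compactin[OF _ triangulation_continuous[OF tri \<phi>(1)]]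
      by (simp add: compactin_subtopology compact_std_triangle)
    then show ?case using haus compactin_imp_closedin by blast
  qed
  have ne: "?K \<Omega> \<noteq> {}" if "\<Omega> \<noteq> {}" for \<Omega>
    using that corner_in_std_triangle by blast
  have inside: "\<phi> b \<notin> verts T" if int: "\<phi> \<in> T" "b \<in> open_face UNIV" for \<phi> b
  proof
    assume "\<phi> b \<in> verts T"
    then obtain \<psi> i where "\<psi> \<in> T" "\<phi> b = \<psi> (corner i)" by (auto simp: verts_def)
    then show False
      using triangulation_faces(1)[OF tri int(1) _ int(2) corner_in_open_face] by auto
  qed
  have dense: "\<exists>y\<in>N. y \<in> ?K \<Omega> - verts T"
    if x: "\<Omega> \<subseteq> T" "openin X N" "x \<in> N" "x \<in> ?K \<Omega>" for \<Omega> N x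
  proof -
    obtain \<phi> b where \<phi>: "\<phi> \<in> \<Omega>" "b \<in> std_triangle" "x = \<phi> b" using x(4) by blast
    have "openin (top_of_set std_triangle) {c \<in> std_triangle. \<phi> c \<in> N}"
      using openin_continuous_map_preimage[OF triangulation_continuous[OF tri] x(2)] \<phi>(1) x(1) by auto
    then obtain G where G: "open G" "{c \<in> std_triangle. \<phi> c \<in> N} = std_triangle \<inter> G"
      by (auto simp: openin_open)
    have "b \<in> closure (open_face UNIV)"
      using \<phi>(2) closed_face_subset_closure[of UNIV] by (auto simp: std_triangle_eq)
    moreover have "b \<in> G" using \<phi> x(3) G(2) by blast
    ultimately obtain c where c: "c \<in> open_face UNIV" "c \<in> G"
      using G(1) by (meson disjoint_iff open_Int_closure_eq_empty)
    then have "c \<in> std_triangle" using open_face_subset by blast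
    then show ?thesis using c G(2) \<phi>(1) inside x(1) by blast
  qed
  have meet: "?K \<Omega> \<inter> ?K (T - \<Omega>) \<subseteq> verts T"
  proof
    fix x assume "x \<in> ?K \<Omega> \<inter> ?K (T - \<Omega>)"
    then obtain \<phi> b \<psi> c where *: "\<phi> \<in> \<Omega>" "b \<in> std_triangle" "x = \<phi> b"
      "\<psi> \<in> T - \<Omega>" "c \<in> std_triangle" "x = \<psi> c" by blast
    obtain A where A: "A \<noteq> {}" "b \<in> open_face A" using std_triangle_cases[OF *(2)] .
    obtain B where B: "B \<noteq> {}" "c \<in> open_face B" using std_triangle_cases[OF *(5)] .
    have T: "\<phi> \<in> T" "\<psi> \<in> T" using * Om by auto
    have eq: "\<phi> b = \<psi> c" using * by simp
    note faces = triangulation_faces[OF tri T A(2) B(2) eq]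
    have "card A \<le> card (UNIV :: 3 set)" by (intro card_mono) auto
    moreover have "card A \<noteq> 0" using A(1) by simp
    ultimately consider "card A = 1" | "card A = 2" | "card A = 3" by fastforce
    then show "x \<in> verts T"
    proof cases
      case 1
      then obtain i where "A = {i}" by (auto simp: card_1_singleton_iff)
      then show ?thesis using A T * by (auto simp: open_face_singleton verts_def)
    next
      case 2
      have side: "\<exists>i. C = - {i}" if "card C = 2" for C :: "3 set"
      proof -
        have "card (- C) = 1" using that by (simp add: Compl_eq_Diff_UNIV card_Diff_subset)
        then show ?thesis by (metis card_1_singleton_iff double_complement One_nat_def)
      qed
      obtain i k where "A = - {i}" "B = - {k}" using side 2 faces(1) by metis
      then show ?thesis using faces(2) nocross *(1,4) by (auto simp: open_side_def)
    next
      case 3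
      then have "A = UNIV" "B = UNIV" using faces(1) card_subset_eq[of UNIV A] card_subset_eq[of UNIV B] by simp_all
      then have "\<phi> = \<psi>" using triangulation_interior[OF tri T] A B eq by blast
      then show ?thesis using * by auto
    qed
  qed
  have sub: "\<Omega> \<subseteq> T" "T - \<Omega> \<subseteq> T" "T - \<Omega> \<noteq> {}" using Om by auto
  show False
  proof (rule connected_minus_isolated_intersection[OF surf closed[OF sub(1)] closed[OF sub(2)] _
        ne[OF Om(1)] ne[OF sub(3)] finite_verts[OF tri] meet])
    show "?K \<Omega> \<union> ?K (T - \<Omega>) = topspace X"
      unfolding triangulation_cover[OF tri, symmetric] UN_Un[symmetric]
      using sub(1) by (simp add: Un_absorb1)
  next
    fix x N assume "openin X N" "x \<in> N" "x \<in> ?K \<Omega>"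
    then show "\<exists>y\<in>N. y \<in> ?K \<Omega> - verts T" by (rule dense[OF sub(1)])
  next
    fix x N assume "openin X N" "x \<in> N" "x \<in> ?K (T - \<Omega>)"
    then show "\<exists>y\<in>N. y \<in> ?K (T - \<Omega>) - verts T" by (rule dense[OF sub(2)])
  qed
qed

section \<open>Condition (A), and condition (B) for regular triangulations\<close>

text \<open>Each edge within \<open>\<Omega>\<close> comes from two sides of triangles in \<open>\<Omega>\<close>, and the edge across which \<open>\<Omega>\<close> can
  be left accounts for a further side.\<close>

lemma edges_within_density:
  assumes tri: "triangulation X T" and surf: "closed_connected_surface X"
    and Om: "\<Omega> \<noteq> {}" "\<Omega> \<subset> T"
  shows "2 * card (edges_within (edges T) (\<lambda>e. {\<phi>\<in>T. \<exists>i. \<phi> ` open_side i = e}) \<Omega>) < 3 * card \<Omega>"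
proof -
  let ?E = "edges_within (edges T) (\<lambda>e. {\<phi>\<in>T. \<exists>i. \<phi> ` open_side i = e}) \<Omega>"
  let ?S = "{p \<in> \<Omega> \<times> UNIV. (\<lambda>(\<phi>, i). \<phi> ` open_side i) p \<in> ?E}"
  have fin: "finite \<Omega>" "finite ?E"
    using Om triangulation_finite[OF tri] finite_edges[OF tri]
    by (auto simp: edges_within_def finite_subset)
  have sub: "sides_on T e = {p \<in> ?S. (\<lambda>(\<phi>, i). \<phi> ` open_side i) p = e}" if "e \<in> ?E" for e
    using that Om(2) by (auto simp: sides_on_def edges_within_def)
  have "2 * card ?E = (\<Sum>e\<in>?E. card (sides_on T e))"
    using card_sides_on[OF tri] by (simp add: edges_within_def)
  also have "\<dots> = (\<Sum>e\<in>?E. \<Sum>p | p \<in> ?S \<and> (\<lambda>(\<phi>, i). \<phi> ` open_side i) p = e. 1)"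
    using sub by simp
  also have "\<dots> = (\<Sum>p\<in>?S. 1)"
    using fin by (intro sum.group) auto
  also have "\<dots> = card ?S" by simp
  also have "card ?S < card (\<Omega> \<times> (UNIV :: 3 set))"
  proof (rule psubset_card_mono)
    obtain \<phi> \<psi> i k where c: "\<phi> \<in> \<Omega>" "\<psi> \<in> T - \<Omega>" "\<phi> ` open_side i = \<psi> ` open_side k"
      using dual_connected[OF tri surf Om] .
    then have "\<phi> ` open_side i \<notin> ?E" unfolding edges_within_def by fastforce
    then have "(\<phi>, i) \<in> \<Omega> \<times> UNIV - ?S" using c(1) by simp
    then show "?S \<subset> \<Omega> \<times> UNIV" by (intro psubsetI) auto
  qed (use fin in simp)
  finally show ?thesis by (simp add: card_cartesian_product)
qed

lemma condition_A_dual_voronoi: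
  assumes tri: "triangulation X T" and surf: "closed_connected_surface X"
  shows "condition_A (dual_voronoi T)"
proof -
  let ?ends = "\<lambda>e. {\<phi>\<in>T. \<exists>i. \<phi> ` open_side i = e}"
  let ?d = "\<lambda>\<Omega>. real (card (edges_within (edges T) ?ends \<Omega>)) / real (card \<Omega>)"
  have fin: "finite T" using triangulation_finite[OF tri] .
  have eq: "3 * card T = 2 * card (edges T)" using three_triangles_eq_two_edges[OF tri] .
  have "topspace X \<noteq> {}" using surf unfolding closed_connected_surface_def by blast
  then have "T \<noteq> {}" using triangulation_cover[OF tri] by blast
  then obtain \<phi> where \<phi>: "\<phi> \<in> T" by blast
  \<comment> \<open>By parity there are at least two triangles, so that the maximum in (A) is taken over a
    nonempty set.\<close>
  have "T \<noteq> {\<phi>}"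
  proof
    assume "T = {\<phi>}"
    then have "card T = 1" by simp
    with eq show False by presburger
  qed
  then have "?d {\<phi>} \<in> {?d \<Omega> |\<Omega>. \<Omega> \<noteq> {} \<and> \<Omega> \<subset> T}" using \<phi> by blast
  moreover have "finite {?d \<Omega> |\<Omega>. \<Omega> \<noteq> {} \<and> \<Omega> \<subset> T}"
  proof (rule finite_subset)
    show "{?d \<Omega> |\<Omega>. \<Omega> \<noteq> {} \<and> \<Omega> \<subset> T} \<subseteq> ?d ` Pow T" by blast
  qed (use fin in simp)
  moreover have "?d \<Omega> < real (card (edges T)) / real (card T)" if "\<Omega> \<noteq> {}" "\<Omega> \<subset> T" for \<Omega>
  proof -
    have "card \<Omega> > 0" "card T > 0"
      using that fin \<phi> by (auto simp: card_gt_0_iff finite_subset)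
    moreover have "2 * real (card (edges_within (edges T) ?ends \<Omega>)) < 3 * real (card \<Omega>)"
      using edges_within_density[OF tri surf that] by linarith
    moreover have "3 * real (card T) = 2 * real (card (edges T))" using eq by linarith
    ultimately have "?d \<Omega> < 3 / 2" "real (card (edges T)) / real (card T) = 3 / 2"
      by (simp_all add: field_simps)
    then show ?thesis by linarith
  qed
  ultimately have "Max {?d \<Omega> |\<Omega>. \<Omega> \<noteq> {} \<and> \<Omega> \<subset> T} < real (card (edges T)) / real (card T)"
    by (subst Max_less_iff) auto
  then show ?thesis by (simp add: condition_A_def dual_voronoi_def)
qed

text \<open>There are \<open>6 |I|\<close> corners at the vertices of \<open>I\<close>, all of them in triangles of \<open>F\<^sub>I\<close>. Some triangle
  of \<open>F\<^sub>I\<close> has a corner outside \<open>I\<close>: if \<open>F\<^sub>I\<close> is not everything, then a triangle of \<open>F\<^sub>I\<close>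
  shares an edge with a triangle that does not meet \<open>I\<close>.\<close>

lemma condition_B_if_6_regular:
  assumes tri: "triangulation X T" and surf: "closed_connected_surface X"
    and deg: "\<forall>v\<in>verts T. vdegree T v = 6"
  shows "condition_B T"
  unfolding condition_B_def
proof (intro allI impI, elim conjE)
  fix I assume I: "I \<noteq> {}" "I \<subset> verts T"
  have haus: "Hausdorff_space X" using surf by (simp add: closed_connected_surface_def)
  have fin: "finite T" "finite (verts T)" "finite I"
    using triangulation_finite[OF tri] finite_verts[OF tri] I by (auto simp: finite_subset)
  have corners: "card (corners_at T v) = 6" if "v \<in> verts T" for v
    using card_corners_at[OF tri haus] deg that by simp
  let ?F = "triangles_meeting T I" and ?c = "\<lambda>(\<phi>, j). \<phi> (corner j)"
  have F: "?F \<subseteq> T" by (auto simp: triangles_meeting_def)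
  have finF: "finite ?F" using F fin(1) finite_subset by blast
  let ?S = "{p \<in> ?F \<times> UNIV. ?c p \<in> I}"
  have sub: "corners_at T v = {p \<in> ?S. ?c p = v}" if "v \<in> I" for v
    using that by (auto simp: corners_at_def triangles_meeting_def)
  have "6 * card I = (\<Sum>v\<in>I. card (corners_at T v))"
    using corners I(2) by (simp add: psubset_eq subset_iff)
  also have "\<dots> = (\<Sum>v\<in>I. \<Sum>p | p \<in> ?S \<and> ?c p = v. 1)"
    using sub by simp
  also have "\<dots> = (\<Sum>p\<in>?S. 1)"
    using fin finF by (intro sum.group) auto
  also have "\<dots> = card ?S" by simp
  also have "card ?S < card (?F \<times> (UNIV :: 3 set))"
  proof (rule psubset_card_mono)
    obtain \<phi> j where "\<phi> \<in> ?F" "\<phi> (corner j) \<notin> I"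
    proof (cases "?F = T")
      case True
      then show ?thesis using I(2) that by (auto simp: verts_def)
    next
      case False
      obtain v where "v \<in> I" "v \<in> verts T" using I by blast
      then have "?F \<noteq> {}" by (auto simp: verts_def triangles_meeting_def)
      moreover have "?F \<subset> T" using F False by blast
      ultimately obtain \<phi> \<psi> i k where c: "\<phi> \<in> ?F" "\<psi> \<in> T - ?F" "\<phi> ` open_side i = \<psi> ` open_side k"
        using dual_connected[OF tri surf] by metis
      have "- {i} \<noteq> {}" using card_side[of i] by auto
      then obtain j where "j \<in> - {i}" by blast
      then have "\<phi> (corner j) \<in> \<psi> ` corner ` (- {k})"
        using side_ends_cong[OF tri haus _ _ c(3)] c(1,2) F by blast
      then have "\<phi> (corner j) \<notin> I" using c(2) by (auto simp: triangles_meeting_def)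
      then show ?thesis using c(1) that by blast
    qed
    then have "(\<phi>, j) \<in> ?F \<times> UNIV - ?S" by simp
    then show "?S \<subset> ?F \<times> UNIV" by (intro psubsetI) auto
  qed (use finF in simp)
  finally have lt: "2 * card I < card ?F" by (simp add: card_cartesian_product)
  have "3 * card T = 6 * card (verts T)"
    using three_triangles_eq_corners[OF tri] corners by simp
  then have "real (card T) = 2 * real (card (verts T))" by linarith
  moreover have "card (verts T) > 0" "card I > 0"
    using I fin by (auto simp: card_gt_0_iff)
  ultimately have "real (card T) / real (card (verts T)) = 2" by simp
  moreover have "2 < real (card ?F) / real (card I)"
    using lt \<open>card I > 0\<close> by (simp add: field_simps)
  ultimately show "real (card T) / real (card (verts T)) < real (card ?F) / real (card I)" by simp
qed

section \<open>The length metric of a compact set\<close>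

text \<open>A 1-Lipschitz path on an interval of length \<open>L\<close> is a path of length at most \<open>L\<close>, run through at
  a speed of at most one. This replaces the length functional and makes the competing paths
  equicontinuous.\<close>

definition joined_within :: "'b::metric_space set \<Rightarrow> real \<Rightarrow> 'b \<Rightarrow> 'b \<Rightarrow> bool" where
  "joined_within S L x y \<longleftrightarrow> 0 \<le> L \<and>
     (\<exists>\<gamma>. 1-lipschitz_on {0..L} \<gamma> \<and> \<gamma> ` {0..L} \<subseteq> S \<and> \<gamma> 0 = x \<and> \<gamma> L = y)"

definition path_dist :: "'b::metric_space set \<Rightarrow> 'b \<Rightarrow> 'b \<Rightarrow> real" where
  "path_dist S x y = Inf {L. joined_within S L x y}"

lemma joined_within_ge_dist: "joined_within S L x y \<Longrightarrow> dist x y \<le> L"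
  unfolding joined_within_def
  by (auto dest!: lipschitz_onD[where x=0 and y=L] simp: dist_real_def)

lemma joined_within_sym:
  assumes "joined_within S L x y" shows "joined_within S L y x"
proof -
  obtain \<gamma> where \<gamma>: "0 \<le> L" "1-lipschitz_on {0..L} \<gamma>" "\<gamma> ` {0..L} \<subseteq> S" "\<gamma> 0 = x" "\<gamma> L = y"
    using assms by (auto simp: joined_within_def)
  have "1-lipschitz_on {0..L} (\<lambda>t. \<gamma> (L - t))"
    using \<gamma>(2) by (auto simp: lipschitz_on_def dist_real_def abs_minus_commute Ball_def)
      (smt (verit, del_insts))
  moreover have "(\<lambda>t. \<gamma> (L - t)) ` {0..L} \<subseteq> S" using \<gamma>(3) by auto
  ultimately show ?thesis
    unfolding joined_within_def using \<gamma> by (intro conjI exI[of _ "\<lambda>t. \<gamma> (L - t)"]) auto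
qed

lemma joined_within_trans:
  assumes "joined_within S L x y" "joined_within S M y z" shows "joined_within S (L + M) x z"
proof -
  obtain \<gamma> where \<gamma>: "0 \<le> L" "1-lipschitz_on {0..L} \<gamma>" "\<gamma> ` {0..L} \<subseteq> S" "\<gamma> 0 = x" "\<gamma> L = y"
    using assms(1) by (auto simp: joined_within_def)
  obtain \<delta> where \<delta>: "0 \<le> M" "1-lipschitz_on {0..M} \<delta>" "\<delta> ` {0..M} \<subseteq> S" "\<delta> 0 = y" "\<delta> M = z"
    using assms(2) by (auto simp: joined_within_def)
  let ?f = "\<lambda>t. if t \<le> L then \<gamma> t else \<delta> (t - L)"
  have "1-lipschitz_on {L..L + M} (\<lambda>t. \<delta> (t - L))"
    using \<delta>(2) by (auto simp: lipschitz_on_def dist_real_def Ball_def)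
      (smt (verit, del_insts))
  then have "1-lipschitz_on {0..L + M} ?f"
    by (intro lipschitz_on_concat \<gamma>(2)) (simp_all add: \<gamma> \<delta>)
  moreover have "?f ` {0..L + M} \<subseteq> S" using \<gamma>(3) \<delta>(3) by (auto simp: image_subset_iff)
  ultimately show ?thesis
    unfolding joined_within_def using \<gamma> \<delta> by (intro conjI exI[of _ ?f]) auto
qed

lemma joined_within_subpath:
  assumes "1-lipschitz_on {0..L} \<gamma>" "\<gamma> ` {0..L} \<subseteq> S" "0 \<le> s" "s \<le> t" "t \<le> L"
  shows "joined_within S (t - s) (\<gamma> s) (\<gamma> t)"
  unfolding joined_within_def
proof (intro conjI exI[of _ "\<lambda>u. \<gamma> (s + u)"])
  show "1-lipschitz_on {0..t - s} (\<lambda>u. \<gamma> (s + u))"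
    using assms(1,3,4,5) by (auto simp: lipschitz_on_def dist_real_def Ball_def)
      (smt (verit, del_insts))
  show "(\<lambda>u. \<gamma> (s + u)) ` {0..t - s} \<subseteq> S" using assms by auto
qed (use assms in auto)

lemma joined_within_segment:
  fixes x y :: "'b::real_normed_vector"
  assumes "closed_segment x y \<subseteq> S" shows "joined_within S (dist x y) x y"
proof (cases "x = y")
  case True
  then show ?thesis using assms
    unfolding joined_within_def by (intro conjI exI[of _ "\<lambda>_. x"]) auto
next
  case False
  define D where "D = dist x y"
  have D: "D > 0" using False by (simp add: D_def)
  let ?f = "\<lambda>t. (1 - t / D) *\<^sub>R x + (t / D) *\<^sub>R y"
  have "dist (?f s) (?f t) = dist s t" for s t
  proof -
    have "?f s - ?f t = ((s - t) / D) *\<^sub>R (y - x)"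
      by (simp add: algebra_simps diff_divide_distrib)
    then show ?thesis using D by (simp add: dist_norm D_def norm_minus_commute)
  qed
  then have "1-lipschitz_on {0..D} ?f" by (simp add: lipschitz_on_def)
  moreover have "?f ` {0..D} \<subseteq> S"
  proof
    fix z assume "z \<in> ?f ` {0..D}"
    then obtain t where "t \<in> {0..D}" "z = ?f t" by blast
    then have "z \<in> closed_segment x y"
      using D unfolding closed_segment_def by (auto intro!: exI[of _ "t / D"])
    then show "z \<in> S" using assms by blast
  qed
  ultimately show ?thesis
    unfolding joined_within_def D_def[symmetric] using D by (intro conjI exI[of _ ?f]) auto
qed

lemma path_dist_le: "joined_within S L x y \<Longrightarrow> path_dist S x y \<le> L"
  unfolding path_dist_def
  by (intro cInf_lower bdd_belowI[of _ 0]) (auto simp: joined_within_def)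

lemma path_dist_segment:
  fixes x y :: "'b::real_normed_vector"
  assumes "closed_segment x y \<subseteq> S" shows "path_dist S x y = dist x y"
proof (rule antisym)
  show "dist x y \<le> path_dist S x y"
    unfolding path_dist_def using joined_within_segment[OF assms] joined_within_ge_dist
    by (intro cInf_greatest) auto
qed (simp add: path_dist_le joined_within_segment assms)

text \<open>Since all the competing paths are 1-Lipschitz, they subconverge by Arzela--Ascoli, and the
  limit has the infimal length.\<close>

lemma joined_within_path_dist:
  fixes S :: "'b::euclidean_space set"
  assumes S: "compact S" and ex: "\<exists>L. joined_within S L x y"
  shows "joined_within S (path_dist S x y) x y"
proof -
  define d where "d = path_dist S x y"
  have d0: "0 \<le> d" 
    unfolding d_def path_dist_def using ex by (intro cInf_greatest) (auto simp: joined_within_def)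
  have "\<exists>L. joined_within S L x y \<and> d \<le> L \<and> L < d + inverse (real (Suc n))" for n
  proof -
    have "Inf {L. joined_within S L x y} < d + inverse (real (Suc n))"
      by (simp add: d_def path_dist_def)
    then obtain L where "joined_within S L x y" "L < d + inverse (real (Suc n))"
      using cInf_lessD[of "{L. joined_within S L x y}"] ex by auto
    then show ?thesis using path_dist_le unfolding d_def by blast
  qed
  then obtain L where L: "\<And>n. joined_within S (L n) x y" "\<And>n. d \<le> L n"
    "\<And>n. L n < d + inverse (real (Suc n))" by metis
  then have "\<exists>\<gamma>. 1-lipschitz_on {0..L n} \<gamma> \<and> \<gamma> ` {0..L n} \<subseteq> S \<and> \<gamma> 0 = x \<and> \<gamma> (L n) = y" for n
    unfolding joined_within_def by blast
  then obtain \<gamma> where \<gamma>: "\<And>n. 1-lipschitz_on {0..L n} (\<gamma> n)" "\<And>n. \<gamma> n ` {0..L n} \<subseteq> S"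
    "\<And>n. \<gamma> n 0 = x" "\<And>n. \<gamma> n (L n) = y" by metis
  have lip: "norm (\<gamma> n s - \<gamma> n t) \<le> \<bar>s - t\<bar>" if "s \<in> {0..d}" "t \<in> {0..d}" for n s t
  proof -
    have "s \<in> {0..L n}" "t \<in> {0..L n}" using that L(2)[of n] by auto
    then show ?thesis using lipschitz_onD[OF \<gamma>(1)] by (fastforce simp: dist_norm)
  qed
  have inS: "\<gamma> n t \<in> S" if "t \<in> {0..d}" for n t
    using \<gamma>(2)[of n] L(2)[of n] that by auto
  obtain M where M: "\<And>z. z \<in> S \<Longrightarrow> norm z \<le> M"
    using compact_imp_bounded[OF S] by (auto simp: bounded_iff)
  \<comment> \<open>All the paths are cut off at time \<open>d\<close>; at that time the \<open>n\<close>-th path is at distance at most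
    \<open>L n - d\<close> from \<open>y\<close>.\<close>
  obtain g and k :: "nat \<Rightarrow> nat" where g: "strict_mono k" 
    "\<And>e. 0 < e \<Longrightarrow> \<exists>N. \<forall>n t. n \<ge> N \<and> t \<in> {0..d} \<longrightarrow> norm (\<gamma> (k n) t - g t) < e"
  proof (rule Arzela_Ascoli[of "{0..d}" \<gamma> M])
    show "\<exists>\<delta>>0. \<forall>n s. s \<in> {0..d} \<and> norm (t - s) < \<delta> \<longrightarrow> norm (\<gamma> n t - \<gamma> n s) < e"
      if "t \<in> {0..d}" "0 < e" for t e
      using that lip by (intro exI[of _ e]) (auto intro: le_less_trans)
  qed (use M inS in auto)
  have lim: "(\<lambda>n. \<gamma> (k n) t) \<longlonglongrightarrow> g t" if "t \<in> {0..d}" for t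
    unfolding LIMSEQ_def dist_norm using g(2) that by metis
  have "norm (g s - g t) \<le> \<bar>s - t\<bar>" if "s \<in> {0..d}" "t \<in> {0..d}" for s t
    using lip that
    by (intro tendsto_upperbound[OF tendsto_norm[OF tendsto_diff[OF lim lim]]]) auto
  then have "1-lipschitz_on {0..d} g" by (auto simp: lipschitz_on_def dist_norm)
  moreover have "g t \<in> S" if "t \<in> {0..d}" for t
    using closed_sequentially[OF compact_imp_closed[OF S] _ lim] inS that by blast
  moreover have "g 0 = x"
    using lim[of 0] d0 \<gamma>(3) LIMSEQ_unique[OF tendsto_const] by fastforce
  moreover have "g d = y"
  proof -
    have "norm (\<gamma> n d - y) \<le> inverse (real (Suc n))" for n
    proof -
      have "d \<in> {0..L n}" "L n \<in> {0..L n}" using d0 L(2)[of n] by auto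
      from lipschitz_onD[OF \<gamma>(1) this] \<gamma>(4)[of n] L(2)[of n] L(3)[of n]
      show ?thesis by (simp add: dist_norm)
    qed
    then have "(\<lambda>n. \<gamma> n d - y) \<longlonglongrightarrow> 0"
      by (intro Lim_null_comparison[OF _ LIMSEQ_inverse_real_of_nat]) auto
    then have "(\<lambda>n. \<gamma> n d) \<longlonglongrightarrow> y" by (simp add: LIM_zero_iff)
    then have "(\<lambda>n. \<gamma> (k n) d) \<longlonglongrightarrow> y"
      using LIMSEQ_subseq_LIMSEQ[OF _ g(1)] by (fastforce simp: o_def)
    then show ?thesis using lim[of d] d0 LIMSEQ_unique by auto
  qed
  ultimately show ?thesis
    unfolding joined_within_def d_def[symmetric] using d0 by blast
qed


text \<open>A compact set that is locally star-shaped at each of its points, carried to another type by an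
  injection \<open>h\<close> and measured by the lengths of its paths.\<close>

locale conical_length_space =
  fixes S :: "'b::euclidean_space set" and h :: "'b \<Rightarrow> 'c"
  assumes compact: "compact S"
    and inj: "inj_on h S"
    and joined: "\<And>x y. x \<in> S \<Longrightarrow> y \<in> S \<Longrightarrow> \<exists>L. joined_within S L x y"
    and locally_conical: "\<And>x. x \<in> S \<Longrightarrow> \<exists>\<epsilon>>0. \<forall>y\<in>S. dist x y < \<epsilon> \<longrightarrow> closed_segment x y \<subseteq> S"
begin

text \<open>The value \<open>0\<close> off the carrier only serves to make the distance a total nonnegative symmetric
  function, as the type of metrics requires.\<close>

definition length_metric :: "'c metric" where
  "length_metric = metric (h ` S, \<lambda>u v. if u \<in> h ` S \<and> v \<in> h ` S
     then path_dist S (inv_into S h u) (inv_into S h v) else 0)"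

lemma shortest_path: "x \<in> S \<Longrightarrow> y \<in> S \<Longrightarrow> joined_within S (path_dist S x y) x y"
  using joined_within_path_dist[OF compact joined] .

lemma dist_le_path_dist: "x \<in> S \<Longrightarrow> y \<in> S \<Longrightarrow> dist x y \<le> path_dist S x y"
  using joined_within_ge_dist shortest_path by blast

lemma path_dist_commute: "path_dist S x y = path_dist S y x"
  unfolding path_dist_def by (metis joined_within_sym)

lemma path_dist_triangle:
  "x \<in> S \<Longrightarrow> y \<in> S \<Longrightarrow> z \<in> S \<Longrightarrow> path_dist S x z \<le> path_dist S x y + path_dist S y z"
  by (meson path_dist_le joined_within_trans shortest_path)

lemma path_dist_self: "x \<in> S \<Longrightarrow> path_dist S x x = 0"
  using path_dist_segment[of x x S] by simp

lemma Metric_space_length_metric: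
  "Metric_space (h ` S) (\<lambda>u v. if u \<in> h ` S \<and> v \<in> h ` S
     then path_dist S (inv_into S h u) (inv_into S h v) else 0)"
proof
  fix u v
  show "0 \<le> (if u \<in> h ` S \<and> v \<in> h ` S then path_dist S (inv_into S h u) (inv_into S h v) else 0)"
    using dist_le_path_dist inv_into_into[of _ h S] by (smt (verit) zero_le_dist)
  show "(if u \<in> h ` S \<and> v \<in> h ` S then path_dist S (inv_into S h u) (inv_into S h v) else 0) =
        (if v \<in> h ` S \<and> u \<in> h ` S then path_dist S (inv_into S h v) (inv_into S h u) else 0)"
    by (auto simp: path_dist_commute)
next
  fix u v assume uv: "u \<in> h ` S" "v \<in> h ` S"
  then obtain x y where xy: "x \<in> S" "y \<in> S" "u = h x" "v = h y" by blast
  show "(if u \<in> h ` S \<and> v \<in> h ` S then path_dist S (inv_into S h u) (inv_into S h v) else 0) = 0 \<longleftrightarrow> u = v"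
    using uv xy dist_le_path_dist[of x y] path_dist_self[of x]
    by (simp add: inv_into_f_f[OF inj] inj_on_eq_iff[OF inj]) force
next
  fix u v w assume "u \<in> h ` S" "v \<in> h ` S" "w \<in> h ` S"
  then show "(if u \<in> h ` S \<and> w \<in> h ` S then path_dist S (inv_into S h u) (inv_into S h w) else 0)
    \<le> (if u \<in> h ` S \<and> v \<in> h ` S then path_dist S (inv_into S h u) (inv_into S h v) else 0) +
      (if v \<in> h ` S \<and> w \<in> h ` S then path_dist S (inv_into S h v) (inv_into S h w) else 0)"
    by (simp add: path_dist_triangle inv_into_into)
qed

lemma mspace_length_metric [simp]: "mspace length_metric = h ` S"
  unfolding length_metric_def by (rule Metric_space.mspace_metric[OF Metric_space_length_metric])

lemma mdist_length_metric [simp]: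
  "x \<in> S \<Longrightarrow> y \<in> S \<Longrightarrow> mdist length_metric (h x) (h y) = path_dist S x y"
  unfolding length_metric_def Metric_space.mdist_metric[OF Metric_space_length_metric]
  by (simp add: inv_into_f_f[OF inj])

text \<open>Distances along a shortest path are at most the parameter differences; were one of them smaller,
  the triangle inequality would give a shortcut between the end points.\<close>

lemma intrinsic_length_metric: "intrinsic_metric length_metric"
  unfolding intrinsic_metric_def
proof (intro ballI)
  fix u v assume "u \<in> mspace length_metric" "v \<in> mspace length_metric"
  then obtain x y where xy: "x \<in> S" "y \<in> S" "u = h x" "v = h y" by auto
  define D where "D = path_dist S x y"
  have D: "mdist length_metric u v = D" using xy by (simp add: D_def)
  obtain \<gamma> where \<gamma>: "0 \<le> D" "1-lipschitz_on {0..D} \<gamma>" "\<gamma> ` {0..D} \<subseteq> S" "\<gamma> 0 = x" "\<gamma> D = y"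
    using shortest_path[OF xy(1,2)] by (auto simp: joined_within_def D_def)
  have S: "\<gamma> t \<in> S" if "t \<in> {0..D}" for t using \<gamma>(3) that by blast
  have sub: "path_dist S (\<gamma> s) (\<gamma> t) \<le> t - s" if "0 \<le> s" "s \<le> t" "t \<le> D" for s t
    using path_dist_le joined_within_subpath[OF \<gamma>(2,3) that] by blast
  have eq: "path_dist S (\<gamma> s) (\<gamma> t) = t - s" if "0 \<le> s" "s \<le> t" "t \<le> D" for s t
  proof -
    have "D \<le> path_dist S x (\<gamma> s) + path_dist S (\<gamma> s) (\<gamma> t) + path_dist S (\<gamma> t) y"
      using path_dist_triangle[OF xy(1) S[of s] xy(2)] path_dist_triangle[OF S[of s] S[of t] xy(2)] that
      by (simp add: D_def)
    then show ?thesis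
      using sub[of 0 s] sub[of t D] sub[OF that] that \<gamma>(4,5) by simp
  qed
  have eq': "path_dist S (\<gamma> s) (\<gamma> t) = \<bar>s - t\<bar>" if "s \<in> {0..D}" "t \<in> {0..D}" for s t
    using eq[of s t] eq[of t s] path_dist_commute[of "\<gamma> s" "\<gamma> t"] that by (cases "s \<le> t") auto
  show "\<exists>\<gamma>. \<gamma> 0 = u \<and> \<gamma> (mdist length_metric u v) = v \<and>
      (\<forall>t\<in>{0..mdist length_metric u v}. \<gamma> t \<in> mspace length_metric) \<and>
      (\<forall>s\<in>{0..mdist length_metric u v}. \<forall>t\<in>{0..mdist length_metric u v}.
         mdist length_metric (\<gamma> s) (\<gamma> t) = \<bar>s - t\<bar>)"
    unfolding D by (intro exI[of _ "h \<circ> \<gamma>"]) (use \<gamma> S xy eq' in auto)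
qed

text \<open>The segments from a point to the nearby points of \<open>S\<close> stay in \<open>S\<close>, so that the two distances from
  that point agree in a neighbourhood of it.\<close>

lemma openin_length_metric:
  "openin (mtopology_of length_metric) U \<longleftrightarrow>
     U \<subseteq> h ` S \<and> openin (top_of_set S) {x \<in> S. h x \<in> U}"
proof -
  have ball: "Metric_space.mball (mspace length_metric) (mdist length_metric) (h x) r = h ` {y \<in> S. path_dist S x y < r}"
    if "x \<in> S" for x r
  proof -
    have "Metric_space.mball (mspace length_metric) (mdist length_metric) (h x) r =
        {v. h x \<in> h ` S \<and> v \<in> h ` S \<and> mdist length_metric (h x) v < r}"
      using Metric_space.mball_def[OF Metric_space_mspace_mdist, of length_metric] by simp
    then show ?thesis using that by auto
  qed
  have cofinal: "(\<exists>r>0. \<forall>y\<in>S. path_dist S x y < r \<longrightarrow> P y) \<longleftrightarrow> (\<exists>r>0. \<forall>y\<in>S. dist y x < r \<longrightarrow> P y)"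
    if x: "x \<in> S" for x P
  proof
    assume "\<exists>r>0. \<forall>y\<in>S. path_dist S x y < r \<longrightarrow> P y"
    then obtain r where r: "r > 0" "\<forall>y\<in>S. path_dist S x y < r \<longrightarrow> P y" by blast
    obtain \<epsilon> where \<epsilon>: "\<epsilon> > 0" "\<forall>y\<in>S. dist x y < \<epsilon> \<longrightarrow> closed_segment x y \<subseteq> S"
      using locally_conical[OF x] by blast
    show "\<exists>r>0. \<forall>y\<in>S. dist y x < r \<longrightarrow> P y"
      using r \<epsilon> by (intro exI[of _ "min r \<epsilon>"]) (auto simp: path_dist_segment dist_commute)
  next
    assume "\<exists>r>0. \<forall>y\<in>S. dist y x < r \<longrightarrow> P y"
    then show "\<exists>r>0. \<forall>y\<in>S. path_dist S x y < r \<longrightarrow> P y"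
      using dist_le_path_dist[OF x] by (metis dist_commute le_less_trans)
  qed
  have "openin (mtopology_of length_metric) U \<longleftrightarrow> U \<subseteq> h ` S \<and>
      (\<forall>x\<in>S. h x \<in> U \<longrightarrow> (\<exists>r>0. \<forall>y\<in>S. path_dist S x y < r \<longrightarrow> h y \<in> U))"
    unfolding mtopology_of_def Metric_space.openin_mtopology[OF Metric_space_mspace_mdist]
      mspace_length_metric[symmetric]
  proof (intro conj_cong refl)
    let ?Q = "\<lambda>u. \<exists>r>0. Metric_space.mball (mspace length_metric) (mdist length_metric) u r \<subseteq> U"
    assume "U \<subseteq> mspace length_metric"
    then have "(\<forall>u. u \<in> U \<longrightarrow> ?Q u) \<longleftrightarrow> (\<forall>x\<in>S. h x \<in> U \<longrightarrow> ?Q (h x))"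
      by (simp only: mspace_length_metric) blast
    also have "\<dots> \<longleftrightarrow> (\<forall>x\<in>S. h x \<in> U \<longrightarrow> (\<exists>r>0. \<forall>y\<in>S. path_dist S x y < r \<longrightarrow> h y \<in> U))"
      by (intro ball_cong refl) (simp add: ball image_subset_iff Ball_def imp_conjL del: mspace_length_metric)
    finally show "(\<forall>u. u \<in> U \<longrightarrow> ?Q u) \<longleftrightarrow>
      (\<forall>x\<in>S. h x \<in> U \<longrightarrow> (\<exists>r>0. \<forall>y\<in>S. path_dist S x y < r \<longrightarrow> h y \<in> U))" .
  qed
  also have "\<dots> \<longleftrightarrow> U \<subseteq> h ` S \<and>
      (\<forall>x\<in>S. h x \<in> U \<longrightarrow> (\<exists>r>0. \<forall>y\<in>S. dist y x < r \<longrightarrow> h y \<in> U))"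
    by (simp only: cofinal cong: ball_cong)
  also have "\<dots> \<longleftrightarrow> U \<subseteq> h ` S \<and> openin (top_of_set S) {x \<in> S. h x \<in> U}"
    unfolding openin_euclidean_subtopology_iff by (intro conj_cong refl) blast
  finally show ?thesis .
qed

lemma homeomorphic_map_length_metric: "homeomorphic_map (top_of_set S) (mtopology_of length_metric) h"
proof -
  have "continuous_map (top_of_set S) (mtopology_of length_metric) h"
    by (auto simp: continuous_map_def openin_length_metric)
  moreover have "open_map (top_of_set S) (mtopology_of length_metric) h"
    unfolding open_map_def
  proof (intro allI impI)
    fix U assume U: "openin (top_of_set S) U"
    then have "U \<subseteq> S" using openin_imp_subset by blast
    then have "{x \<in> S. h x \<in> h ` U} = U" using inj by (auto simp: inj_on_def)
    then show "openin (mtopology_of length_metric) (h ` U)"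
      using U \<open>U \<subseteq> S\<close> by (auto simp: openin_length_metric)
  qed
  ultimately show ?thesis
    using inj by (intro bijective_open_imp_homeomorphic_map) auto
qed

lemma geodesic_segment:
  assumes "x \<noteq> y" "convex C" "C \<subseteq> S" "x \<in> C" "y \<in> C"
  shows "geodesic length_metric (\<lambda>t. h ((1 - t) *\<^sub>R x + t *\<^sub>R y))"
proof -
  let ?p = "\<lambda>t. (1 - t) *\<^sub>R x + t *\<^sub>R y"
  have p: "?p t \<in> C" if "t \<in> {0..1}" for t
    using that assms by (auto intro: convexD_alt)
  have d: "mdist length_metric (h (?p s)) (h (?p t)) = dist x y * \<bar>s - t\<bar>" if "s \<in> {0..1}" "t \<in> {0..1}" for s t
  proof -
    have "closed_segment (?p s) (?p t) \<subseteq> S"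
      using closed_segment_subset[OF p p assms(2)] that assms(3) by blast
    then have "mdist length_metric (h (?p s)) (h (?p t)) = dist (?p s) (?p t)"
      using p that assms(3) by (subst mdist_length_metric) (auto simp: path_dist_segment)
    also have "?p s - ?p t = (s - t) *\<^sub>R (y - x)" by (simp add: algebra_simps)
    then have "dist (?p s) (?p t) = dist x y * \<bar>s - t\<bar>" by (simp add: dist_norm norm_minus_commute)
    finally show ?thesis .
  qed
  show ?thesis unfolding geodesic_def
    using p assms d by (intro conjI ballI exI[of _ "dist x y"] exI[of _ "1::real"]) auto
qed

end

lemma closed_connected_surface_homeomorphic:
  assumes hom: "homeomorphic_map X Y h" and X: "closed_connected_surface X"
  shows "closed_connected_surface Y"
proof -
  have XY: "X homeomorphic_space Y" using hom homeomorphic_map_imp_homeomorphic_space by blast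
  have "\<exists>U V. openin Y U \<and> y \<in> U \<and> open (V :: (real^2) set) \<and> subtopology Y U homeomorphic_space top_of_set V"
    if "y \<in> topspace Y" for y
  proof -
    have "y \<in> h ` topspace X" using hom that by (simp add: homeomorphic_eq_everything_map)
    then obtain x where x: "x \<in> topspace X" "y = h x" by blast
    then obtain U and V :: "(real^2) set" where U: "openin X U" "x \<in> U" and V: "open V" 
      and hUV: "subtopology X U homeomorphic_space top_of_set V"
      using X by (auto simp: closed_connected_surface_def)
    have "openin Y (h ` U)" using hom U(1) by (simp add: homeomorphic_eq_everything_map open_map_def)
    moreover have "subtopology X U homeomorphic_space subtopology Y (h ` U)"
    proof (rule homeomorphic_map_imp_homeomorphic_space, rule homeomorphic_map_subtopologies[OF hom])
      show "h ` (topspace X \<inter> U) = topspace Y \<inter> h ` U"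
        using U openin_subset[OF U(1)] hom by (auto simp: homeomorphic_eq_everything_map)
    qed
    ultimately have "openin Y (h ` U) \<and> y \<in> h ` U \<and> open V \<and>
        subtopology Y (h ` U) homeomorphic_space top_of_set V"
      using x U V hUV homeomorphic_space_trans homeomorphic_space_sym by blast
    then show ?thesis by blast
  qed
  moreover have "topspace Y \<noteq> {}"
    using X homeomorphic_imp_surjective_map[OF hom] unfolding closed_connected_surface_def by blast
  moreover have "compact_space Y" "connected_space Y" "Hausdorff_space Y"
    using X homeomorphic_compact_space[OF XY]
      homeomorphic_connected_space[OF XY] homeomorphic_Hausdorff_space[OF XY]
    unfolding closed_connected_surface_def by blast+
  ultimately show ?thesis by (simp add: closed_connected_surface_def)
qed

section \<open>Equilateral realization of a simplicial surface\<close>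

text \<open>The affine parametrization of the triangle with corners \<open>e (f 1)\<close>, \<open>e (f 2)\<close>, \<open>e (f 3)\<close>.\<close>

definition char_map :: "('v \<Rightarrow> 'b::euclidean_space) \<Rightarrow> (3 \<Rightarrow> 'v) \<Rightarrow> real^3 \<Rightarrow> 'b" where
  "char_map e f b = (\<Sum>i\<in>UNIV. b $ i *\<^sub>R e (f i))"

lemma linear_char_map: "linear (char_map e f)"
  by (rule linearI) (simp_all add: char_map_def scaleR_add_left sum.distrib scaleR_sum_right)

lemma char_map_corner [simp]: "char_map e f (corner i) = e (f i)"
proof -
  have "char_map e f (corner i) = (\<Sum>j\<in>UNIV. if i = j then e (f j) else 0)"
    unfolding char_map_def by (intro sum.cong) auto
  then show ?thesis by simp
qed

lemma continuous_on_char_map: "continuous_on A (char_map e f)"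
  using linear_char_map linear_continuous_on linear_conv_bounded_linear by blast

text \<open>The link of \<open>v\<close> is the cycle that runs through \<open>xs\<close>: the triangles at \<open>v\<close> are spanned by \<open>v\<close> and
  the pairs of cyclically consecutive entries.\<close>

definition is_link :: "(3 \<Rightarrow> 'v) set \<Rightarrow> 'v \<Rightarrow> 'v list \<Rightarrow> bool" where
  "is_link K v xs \<longleftrightarrow> 3 \<le> length xs \<and> distinct xs \<and>
     range ` {f \<in> K. v \<in> range f} = (\<lambda>(a, b). {v, a, b}) ` set (zip xs (rotate1 xs))"

text \<open>The same cycle as a sequence with \<open>w n = w 0\<close>, which avoids wrapping indices around when the link
  is parametrized.\<close>

locale link_cycle =
  fixes K :: "(3 \<Rightarrow> 'v) set" and v :: 'v and n :: nat and w :: "nat \<Rightarrow> 'v"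
  assumes three: "3 \<le> n" and inj_w: "inj_on w {..<n}" and closed_w: "w n = w 0"
    and link: "range ` {f \<in> K. v \<in> range f} = (\<lambda>i. {v, w i, w (Suc i)}) ` {..<n}"
    and inj_triangles: "f \<in> K \<Longrightarrow> inj f"
begin

lemma w_eq_iff: "i < n \<Longrightarrow> j \<le> n \<Longrightarrow> w i = w j \<longleftrightarrow> i = j \<or> (i = 0 \<and> j = n)"
  using inj_w closed_w by (cases "j = n") (auto simp: inj_on_def)

lemma link_triangle:
  assumes "i < n"
  obtains f where "f \<in> K" "range f = {v, w i, w (Suc i)}"
proof -
  have "{v, w i, w (Suc i)} \<in> range ` {f \<in> K. v \<in> range f}" unfolding link using assms by blast
  then show thesis using that by auto
qed

lemma link_triangle_cases:
  assumes "f \<in> K" "v \<in> range f"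
  obtains i where "i < n" "range f = {v, w i, w (Suc i)}"
proof -
  have "range f \<in> range ` {f \<in> K. v \<in> range f}" using assms by blast
  then show thesis unfolding link using that by blast
qed

lemma w_neq_v: "i \<le> n \<Longrightarrow> w i \<noteq> v"
proof -
  have *: "w i \<noteq> v" if i: "i < n" for i
  proof
    assume "w i = v"
    obtain f where f: "f \<in> K" "range f = {v, w i, w (Suc i)}" using link_triangle[OF i] .
    have "card (range f) = 3" using inj_triangles[OF f(1)] by (simp add: card_image)
    moreover have "card {w i, w (Suc i)} \<le> 2" by (simp add: card_insert_if)
    ultimately show False using f(2) \<open>w i = v\<close> by (simp add: insert_absorb)
  qed
  assume "i \<le> n"
  then show "w i \<noteq> v" using *[of i] *[of 0] three closed_w by (cases "i = n") auto
qed

text \<open>In a cycle of length at least three an edge determines its position; for length two the edges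
  \<open>{w 0, w 1}\<close> and \<open>{w 1, w 2}\<close> would coincide.\<close>

lemma consecutive_inj:
  assumes "i < n" "j < n" "{w i, w (Suc i)} = {w j, w (Suc j)}"
  shows "i = j"
proof (rule ccontr)
  assume "i \<noteq> j"
  then have "w i \<noteq> w j" using assms inj_w by (auto simp: inj_on_def)
  then have "w i = w (Suc j)" "w j = w (Suc i)" using assms(3) by (auto simp: doubleton_eq_iff)
  then show False
    using w_eq_iff[of i "Suc j"] w_eq_iff[of j "Suc i"] assms(1,2) three by auto
qed

lemma link_triangle_inj: "inj_on (\<lambda>i. {v, w i, w (Suc i)}) {..<n}"
proof (rule inj_onI)
  fix i j assume ij: "i \<in> {..<n}" "j \<in> {..<n}" "{v, w i, w (Suc i)} = {v, w j, w (Suc j)}"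
  then have "w i \<noteq> v" "w (Suc i) \<noteq> v" "w j \<noteq> v" "w (Suc j) \<noteq> v"
    by (auto intro!: w_neq_v)
  then have "{w i, w (Suc i)} = {w j, w (Suc j)}" using ij(3) by blast
  then show "i = j" using consecutive_inj ij by blast
qed

lemma triangles_on_link_edge:
  assumes "m < n"
  shows "{D \<in> range ` K. v \<in> D \<and> w m \<in> D} =
    {{v, w m, w (Suc m)}, {v, w (if m = 0 then n - 1 else m - 1), w m}}" (is "_ = {?A, ?B}")
proof -
  let ?p = "if m = 0 then n - 1 else m - 1"
  have p: "?p < n" "w (Suc ?p) = w m" using assms closed_w by auto
  have "{D \<in> range ` K. v \<in> D \<and> w m \<in> D} = {D \<in> range ` {f \<in> K. v \<in> range f}. w m \<in> D}" by auto
  also have "\<dots> = (\<lambda>i. {v, w i, w (Suc i)}) ` {i \<in> {..<n}. w m \<in> {v, w i, w (Suc i)}}"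
    unfolding link by auto
  also have "{i \<in> {..<n}. w m \<in> {v, w i, w (Suc i)}} = {m, ?p}"
  proof -
    have "w m = w i \<longleftrightarrow> i = m" "w m = w (Suc i) \<longleftrightarrow> i = ?p" if "i < n" for i
      using that assms w_eq_iff[of m i] w_eq_iff[of m "Suc i"] by auto
    then have "w m \<in> {v, w i, w (Suc i)} \<longleftrightarrow> i = m \<or> i = ?p" if "i < n" for i
      using that assms w_neq_v[of m] by simp
    then show ?thesis using assms p(1) by blast
  qed
  also have "(\<lambda>i. {v, w i, w (Suc i)}) ` {m, ?p} = {?A, ?B}" using p by simp
  finally show ?thesis .
qed

lemma card_triangles_on_link_edge:
  assumes "m < n"
  shows "card {D \<in> range ` K. v \<in> D \<and> w m \<in> D} = 2"
proof -
  let ?p = "if m = 0 then n - 1 else m - 1"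
  have p: "?p < n" "w (Suc ?p) = w m" "?p \<noteq> m" using assms closed_w three by auto
  have "{v, w m, w (Suc m)} \<noteq> {v, w ?p, w (Suc ?p)}"
    using inj_on_eq_iff[OF link_triangle_inj, of m ?p] assms p(1,3) by simp
  then have neq: "{v, w m, w (Suc m)} \<noteq> {v, w ?p, w m}" unfolding p(2) .
  have pair: "card {A, B} = 2" if "A \<noteq> B" for A B :: "'v set" using that by simp
  show ?thesis unfolding triangles_on_link_edge[OF assms] by (rule pair[OF neq])
qed

end

lemma link_cycle_if_is_link:
  assumes "is_link K v xs" "\<And>f. f \<in> K \<Longrightarrow> inj f"
  shows "link_cycle K v (length xs) (\<lambda>i. xs ! (i mod length xs))"
proof
  have xs: "3 \<le> length xs" "distinct xs" using assms(1) by (auto simp: is_link_def)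
  then show "3 \<le> length xs" by simp
  show "inj_on (\<lambda>i. xs ! (i mod length xs)) {..<length xs}"
    using xs by (auto simp: inj_on_def nth_eq_iff_index_eq)
  have "set (zip xs (rotate1 xs)) = (\<lambda>i. (xs ! (i mod length xs), xs ! (Suc i mod length xs))) ` {..<length xs}"
    by (auto simp: set_zip nth_rotate1 image_iff Bex_def)
  then show "range ` {f \<in> K. v \<in> range f} =
      (\<lambda>i. {v, xs ! (i mod length xs), xs ! (Suc i mod length xs)}) ` {..<length xs}"
    using assms(1) by (simp add: is_link_def image_image)
qed (use assms(2) in auto)

text \<open>A connected closed combinatorial surface, given by labelled triangles, whose vertices \<open>v\<close> are put at
  the orthonormal vectors \<open>e v\<close>. The triangles become equilateral, and the barycentric coordinates
  of a point are its inner products with the vectors \<open>e v\<close>.\<close>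

locale triangle_complex =
  fixes K :: "(3 \<Rightarrow> 'v) set" and e :: "'v \<Rightarrow> 'b::euclidean_space" and W :: "'v set"
  assumes finite_K: "finite K" and K_nonempty: "K \<noteq> {}"
    and W_eq: "W = (\<Union>f\<in>K. range f)"
    and inj_K: "f \<in> K \<Longrightarrow> inj f"
    and unique_K: "f \<in> K \<Longrightarrow> g \<in> K \<Longrightarrow> range f = range g \<Longrightarrow> f = g"
    and orthonormal: "v \<in> W \<Longrightarrow> w \<in> W \<Longrightarrow> e v \<bullet> e w = of_bool (v = w)"
    and links: "v \<in> W \<Longrightarrow> \<exists>xs. is_link K v xs"
    and linked: "v \<in> W \<Longrightarrow> w \<in> W \<Longrightarrow> (v, w) \<in> {(v, w). \<exists>f\<in>K. v \<in> range f \<and> w \<in> range f}\<^sup>*"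
begin

definition cell :: "(3 \<Rightarrow> 'v) \<Rightarrow> 'b set" where
  "cell f = char_map e f ` std_triangle"

definition polyhedron :: "'b set" where
  "polyhedron = (\<Union>f\<in>K. cell f)"

definition support :: "'b \<Rightarrow> 'v set" where
  "support x = {v \<in> W. 0 < x \<bullet> e v}"

lemma vertex_in_W: "f \<in> K \<Longrightarrow> f i \<in> W"
  by (auto simp: W_eq)

lemma finite_W: "finite W"
  using finite_K by (simp add: W_eq)

lemma link_cycle_at:
  assumes "v \<in> W"
  obtains n w where "link_cycle K v n w"
  using links[OF assms] link_cycle_if_is_link inj_K by metis

text \<open>An edge lies in exactly two triangles because a vertex of a cycle has exactly two neighbours.\<close>

lemma two_sides:
  assumes f: "f \<in> K" shows "card {(g, j). g \<in> K \<and> g ` (- {j}) = f ` (- {i})} = 2"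
proof -
  obtain j k where jk: "- {i} = {j, k}" "j \<noteq> k"
    using card_side[of i] by (meson card_2_iff)
  have UNIV: "(UNIV :: 3 set) = {i, j, k}" using jk(1) by blast
  define v u where "v = f j" and "u = f k"
  have vu: "v \<in> W" "u \<noteq> v" using inj_K[OF f] vertex_in_W[OF f] jk(2) by (auto simp: v_def u_def inj_eq)
  obtain n w where "link_cycle K v n w" using link_cycle_at[OF vu(1)] .
  then interpret link_cycle K v n w .
  obtain m where "m < n" "u = w m"
  proof -
    obtain l where l: "l < n" "range f = {v, w l, w (Suc l)}"
      using link_triangle_cases[OF f] by (metis rangeI v_def)
    let ?s = "if Suc l = n then 0 else Suc l"
    have "u = w l \<or> u = w (Suc l)" using l(2) vu(2) by (auto simp: u_def)
    then have "u = w l \<or> u = w ?s" using closed_w by auto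
    moreover have "?s < n" using l(1) by auto
    ultimately show thesis using that l(1) by blast
  qed
  have side: "g ` (- {j}) = {v, u} \<longleftrightarrow> v \<in> range g \<and> u \<in> range g \<and> g j \<noteq> v \<and> g j \<noteq> u" if "g \<in> K" for g j
  proof
    assume "g ` (- {j}) = {v, u}"
    moreover have "g j \<notin> g ` (- {j})" using inj_K[OF that] by (auto simp: inj_eq)
    ultimately show "v \<in> range g \<and> u \<in> range g \<and> g j \<noteq> v \<and> g j \<noteq> u" by auto
  next
    assume *: "v \<in> range g \<and> u \<in> range g \<and> g j \<noteq> v \<and> g j \<noteq> u"
    then have "{v, u} \<subseteq> g ` (- {j})" by auto
    moreover have "card (g ` (- {j})) = 2"
      using inj_K[OF that] card_side by (metis card_image inj_on_subset subset_UNIV)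
    moreover have "card {v, u} = 2" using vu(2) by simp
    ultimately show "g ` (- {j}) = {v, u}" by (metis card_subset_eq finite finite_imageI)
  qed
  let ?S = "{(g, j). g \<in> K \<and> g ` (- {j}) = {v, u}}"
  have "inj_on (\<lambda>p. range (fst p)) ?S"
  proof (rule inj_onI, clarify)
    fix g j g' j' assume g: "g \<in> K" "g' \<in> K" "g ` (- {j}) = {v, u}" "g' ` (- {j'}) = {v, u}"
      and "range (fst (g, j)) = range (fst (g', j'))"
    then have "g = g'" using unique_K by simp
    then have "- {j} = - {j'}" using g inj_K[OF g(1)] by (metis inj_image_eq_iff)
    then show "g = g' \<and> j = j'" using \<open>g = g'\<close> by auto
  qed
  then have "card ?S = card ((\<lambda>p. range (fst p)) ` ?S)" by (simp add: card_image)
  also have "(\<lambda>p. range (fst p)) ` ?S = {D \<in> range ` K. v \<in> D \<and> w m \<in> D}"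
  proof (intro set_eqI iffI)
    fix D assume "D \<in> {D \<in> range ` K. v \<in> D \<and> w m \<in> D}"
    then obtain g where g: "g \<in> K" "D = range g" "v \<in> range g" "u \<in> range g" using \<open>u = w m\<close> by auto
    have "card {v, u} < card (range g)" using inj_K[OF g(1)] vu(2) by (simp add: card_image)
    then obtain x where "x \<in> range g" "x \<notin> {v, u}" by (metis card_mono finite.intros leD subsetI)
    then obtain j where "g j \<notin> {v, u}" by auto
    then have "(g, j) \<in> ?S" using side[OF g(1)] g by simp
    then show "D \<in> (\<lambda>p. range (fst p)) ` ?S" using g(2) by (intro image_eqI[of _ _ "(g, j)"]) simp_all
  next
    fix D assume "D \<in> (\<lambda>p. range (fst p)) ` ?S"
    then obtain g j where g: "g \<in> K" "D = range g" "g ` (- {j}) = {v, u}" by auto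
    then show "D \<in> {D \<in> range ` K. v \<in> D \<and> w m \<in> D}"
      using side[OF g(1), of j] \<open>u = w m\<close> by simp
  qed
  also have "card \<dots> = 2" by (rule card_triangles_on_link_edge[OF \<open>m < n\<close>])
  finally show ?thesis using jk by (simp add: v_def u_def)
qed

lemma card_triangles_at:
  assumes "v \<in> W" "is_link K v xs" shows "card {f \<in> K. v \<in> range f} = length xs"
proof -
  interpret link_cycle K v "length xs" "\<lambda>i. xs ! (i mod length xs)"
    using link_cycle_if_is_link[OF assms(2)] inj_K .
  have "card {f \<in> K. v \<in> range f} = card (range ` {f \<in> K. v \<in> range f})"
    by (intro card_image[symmetric] inj_onI) (auto intro: unique_K)
  also have "\<dots> = length xs" unfolding link using card_image[OF link_triangle_inj] by simp
  finally show ?thesis .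
qed

lemma char_map_coord: "f \<in> K \<Longrightarrow> char_map e f b \<bullet> e (f i) = b $ i"
  unfolding char_map_def inner_sum_left
  using inj_K[of f] by (simp add: orthonormal vertex_in_W inj_eq of_bool_def if_distrib cong: if_cong)

lemma char_map_coord_0: "f \<in> K \<Longrightarrow> v \<in> W \<Longrightarrow> v \<notin> range f \<Longrightarrow> char_map e f b \<bullet> e v = 0"
  unfolding char_map_def inner_sum_left
  by (intro sum.neutral) (auto simp: orthonormal vertex_in_W)

lemma inj_char_map: "f \<in> K \<Longrightarrow> inj (char_map e f)"
  by (rule injI) (metis char_map_coord vec_eq_iff)

lemma support_char_map:
  "f \<in> K \<Longrightarrow> support (char_map e f b) = f ` {i. 0 < b $ i}"
proof -
  assume f: "f \<in> K"
  have "v \<in> range f" if "v \<in> W" "0 < char_map e f b \<bullet> e v" for v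
    using char_map_coord_0[OF f] that by force
  then have "support (char_map e f b) = {v \<in> range f. 0 < char_map e f b \<bullet> e v}"
    using vertex_in_W[OF f] by (auto simp: support_def)
  also have "\<dots> = f ` {i. 0 < char_map e f b \<bullet> e (f i)}" by blast
  finally show ?thesis by (simp add: char_map_coord[OF f])
qed

lemma mem_polyhedron_iff: "x \<in> polyhedron \<longleftrightarrow> (\<exists>f\<in>K. \<exists>b\<in>std_triangle. x = char_map e f b)"
  by (auto simp: polyhedron_def cell_def)

lemma coord_nonneg: "x \<in> polyhedron \<Longrightarrow> v \<in> W \<Longrightarrow> 0 \<le> x \<bullet> e v"
  unfolding mem_polyhedron_iff
proof (elim bexE)
  fix f b assume "v \<in> W" "f \<in> K" "b \<in> std_triangle" "x = char_map e f b"
  then show "0 \<le> x \<bullet> e v"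
    by (cases "v \<in> range f") (auto simp: char_map_coord char_map_coord_0 std_triangle_def)
qed

lemma sum_over_range: "f \<in> K \<Longrightarrow> (\<Sum>v\<in>range f. u v) = (\<Sum>i\<in>UNIV. u (f i))"
  using inj_K[of f] by (simp add: sum.reindex)

lemma sum_coords: "x \<in> polyhedron \<Longrightarrow> (\<Sum>v\<in>W. x \<bullet> e v) = 1"
  unfolding mem_polyhedron_iff
proof (elim bexE)
  fix f b assume f: "f \<in> K" "b \<in> std_triangle" "x = char_map e f b"
  have "(\<Sum>v\<in>W. x \<bullet> e v) = (\<Sum>v\<in>range f. x \<bullet> e v)"
    using f vertex_in_W by (intro sum.mono_neutral_right finite_W) (auto simp: char_map_coord_0)
  also have "\<dots> = (\<Sum>i\<in>UNIV. b $ i)" using f by (simp add: sum_over_range char_map_coord)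
  finally show "(\<Sum>v\<in>W. x \<bullet> e v) = 1" using f by (simp add: std_triangle_def)
qed

lemma barycentric_expansion: "x \<in> polyhedron \<Longrightarrow> x = (\<Sum>v\<in>W. (x \<bullet> e v) *\<^sub>R e v)"
  unfolding mem_polyhedron_iff
proof (elim bexE)
  fix f b assume f: "f \<in> K" "b \<in> std_triangle" "x = char_map e f b"
  have "(\<Sum>v\<in>W. (x \<bullet> e v) *\<^sub>R e v) = (\<Sum>v\<in>range f. (x \<bullet> e v) *\<^sub>R e v)"
    using f vertex_in_W by (intro sum.mono_neutral_right finite_W) (auto simp: char_map_coord_0)
  also have "\<dots> = x" using f by (simp add: sum_over_range char_map_coord) (simp add: char_map_def)
  finally show "x = (\<Sum>v\<in>W. (x \<bullet> e v) *\<^sub>R e v)" ..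
qed

lemma in_cell_if_support:
  assumes x: "x \<in> polyhedron" and f: "f \<in> K" and sub: "support x \<subseteq> range f"
  obtains b where "b \<in> std_triangle" "x = char_map e f b"
proof
  define b :: "real^3" where "b = (\<chi> i. x \<bullet> e (f i))"
  have zero: "x \<bullet> e v = 0" if "v \<in> W - range f" for v
    using that sub coord_nonneg[OF x, of v] by (force simp: support_def order.order_iff_strict)
  have "(\<Sum>v\<in>W. x \<bullet> e v) = (\<Sum>v\<in>range f. x \<bullet> e v)"
    using zero vertex_in_W[OF f] by (intro sum.mono_neutral_right finite_W) auto
  then have "(\<Sum>i\<in>UNIV. b $ i) = 1"
    using sum_coords[OF x] f by (simp add: sum_over_range b_def)
  then show "b \<in> std_triangle"
    using coord_nonneg[OF x] vertex_in_W[OF f] by (auto simp: std_triangle_def b_def)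
  have "x = (\<Sum>v\<in>W. (x \<bullet> e v) *\<^sub>R e v)" by (rule barycentric_expansion[OF x])
  also have "\<dots> = (\<Sum>v\<in>range f. (x \<bullet> e v) *\<^sub>R e v)"
    using zero vertex_in_W[OF f] by (intro sum.mono_neutral_right finite_W) auto
  also have "\<dots> = char_map e f b" using f by (simp add: sum_over_range char_map_def b_def)
  finally show "x = char_map e f b" .
qed

text \<open>The open face of a point is read off from the set of its positive coordinates, so that faces of
  different triangles coincide or are disjoint according to their vertex sets.\<close>

lemma char_map_open_face: "f \<in> K \<Longrightarrow> char_map e f ` open_face A = {x \<in> polyhedron. support x = f ` A}"
proof (intro set_eqI iffI)
  assume f: "f \<in> K"
  fix x assume "x \<in> char_map e f ` open_face A"
  then show "x \<in> {x \<in> polyhedron. support x = f ` A}"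
    using f by (auto simp: open_face_def mem_polyhedron_iff support_char_map)
next
  assume f: "f \<in> K"
  fix x assume x: "x \<in> {x \<in> polyhedron. support x = f ` A}"
  then have "x \<in> polyhedron" "support x \<subseteq> range f" by auto
  then obtain b where b: "b \<in> std_triangle" "x = char_map e f b"
    by (rule in_cell_if_support[OF _ f])
  then have "f ` {i. 0 < b $ i} = f ` A" using x f by (simp add: support_char_map)
  then have "{i. 0 < b $ i} = A" using inj_K[OF f] by (simp add: inj_image_eq_iff)
  then show "x \<in> char_map e f ` open_face A" using b by (auto simp: open_face_def)
qed

lemma char_map_closed_face: "f \<in> K \<Longrightarrow> char_map e f ` closed_face A = {x \<in> polyhedron. support x \<subseteq> f ` A}"
proof (intro set_eqI iffI)
  assume f: "f \<in> K"
  fix x assume "x \<in> char_map e f ` closed_face A"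
  then show "x \<in> {x \<in> polyhedron. support x \<subseteq> f ` A}"
    using f by (auto simp: closed_face_def mem_polyhedron_iff support_char_map intro!: imageI)
next
  assume f: "f \<in> K"
  fix x assume x: "x \<in> {x \<in> polyhedron. support x \<subseteq> f ` A}"
  then have "x \<in> polyhedron" "support x \<subseteq> range f" by auto
  then obtain b where b: "b \<in> std_triangle" "x = char_map e f b"
    by (rule in_cell_if_support[OF _ f])
  then have "f ` {i. 0 < b $ i} \<subseteq> f ` A" using x f by (simp add: support_char_map)
  then have "{i. 0 < b $ i} \<subseteq> A" using inj_K[OF f] by (simp add: inj_image_subset_iff)
  then show "x \<in> char_map e f ` closed_face A" using b by (auto simp: closed_face_def)
qed

lemma cell_subset: "f \<in> K \<Longrightarrow> cell f \<subseteq> polyhedron"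
  by (auto simp: polyhedron_def)

lemma convex_cell: "convex (cell f)"
  unfolding cell_def by (intro convex_linear_image linear_char_map convex_std_triangle)

lemma compact_cell: "compact (cell f)"
  unfolding cell_def by (intro compact_continuous_image continuous_on_char_map compact_std_triangle)

lemma vertex_in_cell: "e (f i) \<in> cell f"
  unfolding cell_def by (metis char_map_corner corner_in_std_triangle imageI)

lemma compact_polyhedron: "compact polyhedron"
  unfolding polyhedron_def using finite_K compact_cell by (intro compact_UN) auto

text \<open>Near \<open>x\<close> only the finitely many cells that contain \<open>x\<close> are met.\<close>

lemma polyhedron_locally_conical:
  assumes "x \<in> polyhedron"
  shows "\<exists>\<epsilon>>0. \<forall>y\<in>polyhedron. dist x y < \<epsilon> \<longrightarrow> closed_segment x y \<subseteq> polyhedron"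
proof -
  let ?far = "\<Union>f\<in>{f \<in> K. x \<notin> cell f}. cell f"
  have "closed ?far" 
    using finite_K compact_cell by (intro closed_UN) (auto intro: compact_imp_closed)
  moreover have "x \<notin> ?far" by auto
  ultimately obtain \<epsilon> where \<epsilon>: "\<epsilon> > 0" "ball x \<epsilon> \<subseteq> - ?far"
    by (meson open_Compl ComplI openE)
  have "closed_segment x y \<subseteq> polyhedron" if y: "y \<in> polyhedron" "dist x y < \<epsilon>" for y
  proof -
    have "y \<notin> ?far" using \<epsilon>(2) y(2) by auto
    then obtain f where "f \<in> K" "x \<in> cell f" "y \<in> cell f"
      using y(1) by (auto simp: polyhedron_def)
    then show ?thesis using closed_segment_subset[OF _ _ convex_cell] cell_subset by blast
  qed
  then show ?thesis using \<epsilon>(1) by blast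
qed

lemma joined_in_cell:
  "f \<in> K \<Longrightarrow> x \<in> cell f \<Longrightarrow> y \<in> cell f \<Longrightarrow> joined_within polyhedron (dist x y) x y"
  by (meson cell_subset closed_segment_subset convex_cell joined_within_segment subset_trans)

lemma polyhedron_joined:
  assumes "x \<in> polyhedron" "y \<in> polyhedron"
  shows "\<exists>L. joined_within polyhedron L x y"
proof -
  have verts: "\<exists>L. joined_within polyhedron L (e v) (e w)" if v: "v \<in> W" and "w \<in> W" for v w
    using linked[OF that]
  proof (induction rule: rtrancl_induct)
    case base
    obtain f i where "f \<in> K" "v = f i" using v by (auto simp: W_eq)
    then show ?case using joined_in_cell vertex_in_cell by blast
  next
    case (step u w)
    then obtain f i j where "f \<in> K" "u = f i" "w = f j" by auto
    then have "joined_within polyhedron (dist (e u) (e w)) (e u) (e w)"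
      using joined_in_cell vertex_in_cell by blast
    then show ?case using step.IH joined_within_trans by blast
  qed
  obtain f g where f: "f \<in> K" "x \<in> cell f" and g: "g \<in> K" "y \<in> cell g"
    using assms by (auto simp: polyhedron_def)
  obtain L where "joined_within polyhedron L (e (f 1)) (e (g 1))"
    using verts vertex_in_W f(1) g(1) by blast
  moreover have "joined_within polyhedron (dist x (e (f 1))) x (e (f 1))"
    using f joined_in_cell vertex_in_cell by blast
  moreover have "joined_within polyhedron (dist (e (g 1)) y) (e (g 1)) y"
    using g joined_in_cell vertex_in_cell by blast
  ultimately show ?thesis using joined_within_trans by blast
qed

end

text \<open>The polyhedron carried to a type of points of choice, with its length metric.\<close>

locale placed_complex = triangle_complex K e W 
  for K :: "(3 \<Rightarrow> 'v) set" and e :: "'v \<Rightarrow> 'b::euclidean_space" and W :: "'v set" +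
  fixes h :: "'b \<Rightarrow> 'c"
  assumes inj_h: "inj_on h polyhedron"
begin

sublocale conical_length_space polyhedron h
  by unfold_locales (simp_all add: compact_polyhedron inj_h polyhedron_joined polyhedron_locally_conical)

definition placed :: "(3 \<Rightarrow> 'v) \<Rightarrow> real^3 \<Rightarrow> 'c" where
  "placed f = h \<circ> char_map e f"

definition realization :: "'c triangulation" where
  "realization = placed ` K"

lemma placed_corner: "placed f (corner i) = h (e (f i))"
  by (simp add: placed_def)

lemma vertex_in_polyhedron: "v \<in> W \<Longrightarrow> e v \<in> polyhedron"
  using vertex_in_cell by (auto simp: W_eq polyhedron_def)

lemma inj_vertices: "inj_on (\<lambda>v. h (e v)) W"
proof (rule inj_onI)
  fix v w assume "v \<in> W" "w \<in> W" "h (e v) = h (e w)"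
  then have "e v = e w" using inj_h vertex_in_polyhedron by (simp add: inj_on_eq_iff)
  then show "v = w" using orthonormal[of v w] orthonormal[of v v] \<open>v \<in> W\<close> \<open>w \<in> W\<close> by (simp split: if_splits)
qed

lemma placed_vertex_eq_iff: "v \<in> W \<Longrightarrow> w \<in> W \<Longrightarrow> h (e v) = h (e w) \<longleftrightarrow> v = w"
  using inj_on_eq_iff[OF inj_vertices] .

lemma inj_placed: "inj_on placed K"
proof (rule inj_onI)
  fix f g assume "f \<in> K" "g \<in> K" "placed f = placed g"
  then have "h (e (f i)) = h (e (g i))" for i by (metis placed_corner)
  then have "f i = g i" for i
    using inj_onD[OF inj_vertices] \<open>f \<in> K\<close> \<open>g \<in> K\<close> vertex_in_W by blast
  then show "f = g" by blast
qed

lemma placed_open_face: "f \<in> K \<Longrightarrow> placed f ` open_face A = h ` {x \<in> polyhedron. support x = f ` A}"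
  by (simp only: placed_def image_comp[symmetric] char_map_open_face)

lemma placed_closed_face: "f \<in> K \<Longrightarrow> placed f ` closed_face A = h ` {x \<in> polyhedron. support x \<subseteq> f ` A}"
  by (simp only: placed_def image_comp[symmetric] char_map_closed_face)

lemma placed_faces_meet:
  assumes "f \<in> K" "g \<in> K" "placed f ` open_face A \<inter> placed g ` open_face B \<noteq> {}"
  shows "f ` A = g ` B"
proof -
  obtain x y where "x \<in> polyhedron" "y \<in> polyhedron" "h x = h y" "support x = f ` A" "support y = g ` B"
    using assms(3) unfolding placed_open_face[OF assms(1)] placed_open_face[OF assms(2)] by blast
  then show ?thesis using inj_h by (metis inj_onD)
qed

lemma inj_placed_std_triangle: "f \<in> K \<Longrightarrow> inj_on (placed f) std_triangle"
  unfolding placed_def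
  by (intro comp_inj_on inj_on_subset[OF inj_char_map] inj_on_subset[OF inj_h])
     (use cell_subset in \<open>auto simp: cell_def\<close>)

lemma triangulation_realization: "triangulation (mtopology_of length_metric) realization"
  unfolding triangulation_def
proof (intro conjI ballI allI impI)
  show "finite realization" by (simp add: realization_def finite_K)
next
  fix \<phi> assume "\<phi> \<in> realization"
  then obtain f where f: "f \<in> K" "\<phi> = placed f" by (auto simp: realization_def)
  have "continuous_map (top_of_set std_triangle) (top_of_set polyhedron) (char_map e f)"
    using f cell_subset continuous_on_char_map by (auto simp: cell_def continuous_map_subtopology_eu)
  then show "continuous_map (top_of_set std_triangle) (mtopology_of length_metric) \<phi>"
    using homeomorphic_imp_continuous_map[OF homeomorphic_map_length_metric]
    unfolding f placed_def by (rule continuous_map_compose)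
  show "inj_on \<phi> (open_face A)" for A
    unfolding f using f inj_on_subset[OF inj_placed_std_triangle open_face_subset] by blast
next
  have "(\<Union>\<phi>\<in>realization. \<phi> ` std_triangle) = h ` (\<Union>f\<in>K. cell f)"
    by (auto simp: realization_def placed_def cell_def image_UN image_comp)
  also have "\<dots> = topspace (mtopology_of length_metric)"
    by (simp flip: polyhedron_def)
  finally show "(\<Union>\<phi>\<in>realization. \<phi> ` std_triangle) = topspace (mtopology_of length_metric)" .
next
  fix \<phi> \<psi> A B assume "\<phi> \<in> realization" "\<psi> \<in> realization"
    and meet: "\<phi> ` open_face A \<inter> \<psi> ` open_face B \<noteq> {}"
  then obtain f g where fg: "f \<in> K" "\<phi> = placed f" "g \<in> K" "\<psi> = placed g" by (auto simp: realization_def)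
  then have eq: "f ` A = g ` B" using placed_faces_meet[OF fg(1,3), of A B] meet by simp
  then show "card A = card B"
    using inj_K[OF fg(1)] inj_K[OF fg(3)] by (metis card_image inj_on_subset subset_UNIV)
  show "\<phi> ` open_face A = \<psi> ` open_face B" using fg eq by (simp add: placed_open_face)
next
  fix \<phi> \<psi> assume "\<phi> \<in> realization" "\<psi> \<in> realization"
    and meet: "\<phi> ` open_face UNIV \<inter> \<psi> ` open_face UNIV \<noteq> {}"
  then obtain f g where fg: "f \<in> K" "\<phi> = placed f" "g \<in> K" "\<psi> = placed g" by (auto simp: realization_def)
  then have "range f = range g"
    using placed_faces_meet[OF fg(1,3), of UNIV UNIV] meet by simp
  then show "\<phi> = \<psi>" using fg unique_K by blast
next
  fix E assume "E \<in> edges realization"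
  then obtain f i where f: "f \<in> K" and E: "E = placed f ` open_side i"
    by (auto simp: edges_def realization_def)
  have same: "placed g ` open_side j = E \<longleftrightarrow> g ` (- {j}) = f ` (- {i})" if "g \<in> K" for g j
  proof
    assume eq: "placed g ` open_side j = E"
    then have "placed g ` open_side j \<inter> placed f ` open_side i \<noteq> {}" using open_side_nonempty[of j] E by auto
    then show "g ` (- {j}) = f ` (- {i})" using placed_faces_meet[OF that f] by (simp add: open_side_def)
  next
    assume "g ` (- {j}) = f ` (- {i})"
    then show "placed g ` open_side j = E" using f that by (simp add: E open_side_def placed_open_face)
  qed
  have "{(\<phi>, j). \<phi> \<in> realization \<and> \<phi> ` open_side j = E} =
      {(placed g, j) |g j. g \<in> K \<and> placed g ` open_side j = E}"
    by (auto simp: realization_def)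
  also have "\<dots> = {(placed g, j) |g j. g \<in> K \<and> g ` (- {j}) = f ` (- {i})}"
    by (intro Collect_cong ex_cong1 conj_cong refl same)
  also have "\<dots> = map_prod placed id ` {(g, j). g \<in> K \<and> g ` (- {j}) = f ` (- {i})}" by force
  also have "card \<dots> = card {(g, j). g \<in> K \<and> g ` (- {j}) = f ` (- {i})}"
    by (intro card_image inj_onI) (auto dest: inj_onD[OF inj_placed])
  finally show "card {(\<phi>, j). \<phi> \<in> realization \<and> \<phi> ` open_side j = E} = 2"
    using two_sides[OF f] by simp
qed

lemma simplicial_realization: "simplicial realization"
  unfolding simplicial_def
proof (intro conjI ballI impI)
  fix \<phi> assume "\<phi> \<in> realization"
  then show "inj_on \<phi> std_triangle" using inj_placed_std_triangle by (auto simp: realization_def)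
next
  fix \<phi> \<psi> assume "\<phi> \<in> realization" "\<psi> \<in> realization"
  then obtain f g where fg: "f \<in> K" "\<phi> = placed f" "g \<in> K" "\<psi> = placed g" by (auto simp: realization_def)
  have "\<phi> ` std_triangle \<inter> \<psi> ` std_triangle =
      h ` ({x \<in> polyhedron. support x \<subseteq> range f} \<inter> {x \<in> polyhedron. support x \<subseteq> range g})"
    unfolding fg std_triangle_eq placed_closed_face[OF fg(1)] placed_closed_face[OF fg(3)]
    by (rule inj_on_image_Int[OF inj_h, symmetric]) auto
  also have "\<dots> = h ` {x \<in> polyhedron. support x \<subseteq> range f \<inter> range g}"
    by (intro arg_cong[where f = "(`) h"]) blast
  finally have eq: "\<phi> ` std_triangle \<inter> \<psi> ` std_triangle = h ` {x \<in> polyhedron. support x \<subseteq> range f \<inter> range g}" .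
  have f: "f ` (f -` range g) = range f \<inter> range g" and g: "g ` (g -` range f) = range f \<inter> range g"
    by auto
  have "\<phi> ` closed_face (f -` range g) = h ` {x \<in> polyhedron. support x \<subseteq> range f \<inter> range g}"
    unfolding fg(2) placed_closed_face[OF fg(1)] f ..
  moreover have "\<psi> ` closed_face (g -` range f) = h ` {x \<in> polyhedron. support x \<subseteq> range f \<inter> range g}"
    unfolding fg(4) placed_closed_face[OF fg(3)] g ..
  ultimately show "\<exists>A B. \<phi> ` std_triangle \<inter> \<psi> ` std_triangle = \<phi> ` closed_face A \<and>
      \<phi> ` closed_face A = \<psi> ` closed_face B"
    using eq by metis
qed

lemma verts_realization: "verts realization = (\<lambda>v. h (e v)) ` W"
proof -
  have "verts realization = (\<Union>f\<in>K. range (\<lambda>i. placed f (corner i)))"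
    unfolding verts_def realization_def by blast
  also have "\<dots> = (\<lambda>v. h (e v)) ` (\<Union>f\<in>K. range f)"
    by (simp add: placed_corner image_UN image_image)
  finally show ?thesis by (simp add: W_eq)
qed

lemma geodesic_triangulation_realization: "geodesic_triangulation length_metric realization"
  unfolding geodesic_triangulation_def
proof (intro conjI triangulation_realization ballI allI impI)
  fix \<phi> and i j :: 3 assume "\<phi> \<in> realization" "i \<noteq> j"
  then obtain f where f: "f \<in> K" "\<phi> = placed f" by (auto simp: realization_def)
  have "f i \<noteq> f j" using inj_K[OF f(1)] \<open>i \<noteq> j\<close> by (simp add: inj_eq)
  then have "e (f i) \<noteq> e (f j)"
    using inj_vertices vertex_in_W[OF f(1)] by (metis inj_onD)
  then have "geodesic length_metric (\<lambda>t. h ((1 - t) *\<^sub>R e (f i) + t *\<^sub>R e (f j)))"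
    using geodesic_segment[OF _ convex_cell cell_subset[OF f(1)]] vertex_in_cell by blast
  then show "geodesic length_metric (\<lambda>t. \<phi> ((1 - t) *\<^sub>R corner i + t *\<^sub>R corner j))"
    unfolding f placed_def o_def
    by (simp add: linear_add[OF linear_char_map] linear_scale[OF linear_char_map])
qed

text \<open>In the ambient space the corners of a triangle are the vertices nearest to its barycentre; the
  length metric agrees with the ambient one on the triangle and is nowhere smaller.\<close>

lemma empty_circumdisc_realization:
  assumes "\<phi> \<in> realization" shows "has_empty_circumdisc length_metric realization \<phi>"
proof -
  obtain f where f: "f \<in> K" "\<phi> = placed f" using assms by (auto simp: realization_def)
  define b :: "real^3" where "b = (\<chi> i. 1 / 3)"
  define c where "c = char_map e f b"
  have "b \<in> std_triangle" by (simp add: b_def std_triangle_def)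
  then have c: "c \<in> cell f" by (simp add: c_def cell_def)
  then have cP: "c \<in> polyhedron" using cell_subset f by blast
  have cv: "c \<bullet> e v = (if v \<in> range f then 1 / 3 else 0)" if "v \<in> W" for v
    using char_map_coord[OF f(1)] char_map_coord_0[OF f(1) that] by (auto simp: c_def b_def)
  have dist2: "(dist c (e v))\<^sup>2 = c \<bullet> c + 1 - 2 * (c \<bullet> e v)" if "v \<in> W" for v
    using orthonormal[OF that that]
    by (simp add: dist_norm power2_norm_eq_inner inner_diff inner_commute algebra_simps)
  define r where "r = dist c (e (f 1))"
  have r2: "r\<^sup>2 = c \<bullet> c + 1 / 3" using dist2[of "f 1"] cv[of "f 1"] vertex_in_W[OF f(1)] by (simp add: r_def)
  have rpos: "r > 0"
  proof -
    have "r\<^sup>2 > 0" unfolding r2 using inner_ge_zero[of c] by linarith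
    then show ?thesis by (simp add: r_def zero_less_dist_iff)
  qed
  have corner: "path_dist polyhedron c (e (f i)) = r" for i
  proof -
    have "path_dist polyhedron c (e (f i)) = dist c (e (f i))"
      using c vertex_in_cell[of f i] cell_subset[OF f(1)] closed_segment_subset[OF _ _ convex_cell]
      by (intro path_dist_segment) blast
    moreover have "(dist c (e (f i)))\<^sup>2 = r\<^sup>2"
      using dist2[of "f i"] cv[of "f i"] vertex_in_W[OF f(1)] r2 by simp
    ultimately show ?thesis using rpos by (simp add: power2_eq_iff_nonneg)
  qed
  have far: "r \<le> path_dist polyhedron c (e v)" if "v \<in> W" for v
  proof -
    have "r\<^sup>2 \<le> (dist c (e v))\<^sup>2" using dist2[OF that] cv[OF that] r2 by simp
    then have "r \<le> dist c (e v)" by (rule power2_le_imp_le) simp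
    also have "\<dots> \<le> path_dist polyhedron c (e v)"
      using dist_le_path_dist cP vertex_in_polyhedron[OF that] by blast
    finally show ?thesis .
  qed
  show ?thesis unfolding has_empty_circumdisc_def
  proof (intro bexI[of _ "h c"] exI[of _ r] conjI allI)
    show "h c \<in> mspace length_metric" using cP by simp
    show "mdist length_metric (h c) (\<phi> (corner i)) = r" for i
      using corner cP vertex_in_polyhedron[OF vertex_in_W[OF f(1)]] by (simp add: f placed_corner)
    show "verts realization \<inter> {x \<in> mspace length_metric. mdist length_metric (h c) x < r} = {}"
    proof -
      have "\<not> mdist length_metric (h c) (h (e v)) < r" if "v \<in> W" for v
        using far[OF that] cP vertex_in_polyhedron[OF that] by simp
      then show ?thesis by (auto simp: verts_realization)
    qed
  qed (rule rpos)
qed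

lemma delaunay_realization: "delaunay length_metric realization"
  by (simp add: delaunay_def geodesic_triangulation_realization empty_circumdisc_realization)

lemma closed_metric_surface_realization:
  "closed_connected_surface (top_of_set polyhedron) \<Longrightarrow> closed_metric_surface length_metric"
  unfolding closed_metric_surface_def
  using closed_connected_surface_homeomorphic[OF homeomorphic_map_length_metric] intrinsic_length_metric by blast

text \<open>By \<open>card_corners_at\<close> the degree is the number of corners, and the corners of a single triangle are
  at different vertices.\<close>

lemma vdegree_realization:
  assumes "v \<in> W"
  shows "vdegree realization (h (e v)) = card {f \<in> K. v \<in> range f}"
proof -
  have haus: "Hausdorff_space (mtopology_of length_metric)"
    by (metis Metric_space.Hausdorff_space_mtopology Metric_space_mspace_mdist mtopology_of_def)
  let ?S = "{(f, i). f \<in> K \<and> f i = v}"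
  have "corners_at realization (h (e v)) = {(placed f, i) |f i. f \<in> K \<and> f i = v}"
    using vertex_in_W assms
    by (auto simp: corners_at_def realization_def placed_corner placed_vertex_eq_iff)
  also have "\<dots> = map_prod placed id ` ?S" by force
  finally have "corners_at realization (h (e v)) = map_prod placed id ` ?S" .
  then have "vdegree realization (h (e v)) = card (map_prod placed id ` ?S)"
    using card_corners_at[OF triangulation_realization haus] by metis
  also have "\<dots> = card ?S"
    by (intro card_image inj_onI) (auto dest: inj_onD[OF inj_placed])
  also have "\<dots> = card (fst ` ?S)"
  proof (intro card_image[symmetric] inj_onI)
    fix p q assume "p \<in> ?S" "q \<in> ?S" "fst p = fst q"
    then show "p = q" using inj_K[of "fst p"] by (cases p; cases q) (auto simp: inj_eq)
  qed
  also have "fst ` ?S = {f \<in> K. v \<in> range f}" by force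
  finally show ?thesis .
qed

lemma card_verts_realization: "card (verts realization) = card W"
  unfolding verts_realization by (rule card_image[OF inj_vertices])

lemma card_realization: "card realization = card K"
  unfolding realization_def by (rule card_image[OF inj_placed])

lemma card_triangles_meeting_realization:
  assumes "J \<subseteq> W"
  shows "card (triangles_meeting realization ((\<lambda>v. h (e v)) ` J)) = card {f \<in> K. range f \<inter> J \<noteq> {}}"
proof -
  have "h (e (f i)) \<in> (\<lambda>v. h (e v)) ` J \<longleftrightarrow> f i \<in> J" if "f \<in> K" for f i
    using assms vertex_in_W[OF that] by (auto simp: placed_vertex_eq_iff subset_iff)
  then have "{f \<in> K. \<exists>i. placed f (corner i) \<in> (\<lambda>v. h (e v)) ` J} = {f \<in> K. range f \<inter> J \<noteq> {}}"
    unfolding placed_corner by blast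
  moreover have "triangles_meeting realization ((\<lambda>v. h (e v)) ` J) =
      placed ` {f \<in> K. \<exists>i. placed f (corner i) \<in> (\<lambda>v. h (e v)) ` J}"
    unfolding triangles_meeting_def realization_def by blast
  ultimately have "triangles_meeting realization ((\<lambda>v. h (e v)) ` J) = placed ` {f \<in> K. range f \<inter> J \<noteq> {}}"
    by simp
  then show ?thesis by (simp add: card_image inj_on_subset[OF inj_placed])
qed

end

section \<open>The open star of a vertex is a disc\<close>

text \<open>The piecewise linear function that is \<open>1\<close> at \<open>k\<close> and \<open>0\<close> at all the other integers. Sums of such
  functions are evidently continuous.\<close>

definition hat :: "real \<Rightarrow> nat \<Rightarrow> real" where
  "hat t k = max 0 (1 - \<bar>t - real k\<bar>)"

lemma hat_at: "real i \<le> t \<Longrightarrow> t \<le> real (Suc i) \<Longrightarrow>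
    hat t k = (if k = i then 1 - (t - i) else if k = Suc i then t - i else 0)"
  by (auto simp: hat_def)

lemma homeomorphism_imp_homeomorphic_space:
  "homeomorphism S T f g \<Longrightarrow> top_of_set S homeomorphic_space top_of_set T"
  unfolding homeomorphic_space_def homeomorphic_maps_def homeomorphism_def
  by (intro exI[of _ f] exI[of _ g]) (auto simp: continuous_map_subtopology_eu)

lemma cis_inj_period:
  assumes n: "0 < n" and t: "0 \<le> t" "t < n" "0 \<le> t'" "t' < n"
    and eq: "cis (2 * pi * t / n) = cis (2 * pi * t' / n)"
  shows "t = t'"
proof -
  have arg: "Arg2pi (cis x) = x" if "0 \<le> x" "x < 2 * pi" for x
    using Arg2pi_exp[of "\<i> * of_real x"] that by (simp add: cis_conv_exp)
  have "0 \<le> 2 * pi * s / n \<and> 2 * pi * s / n < 2 * pi" if "0 \<le> s" "s < n" for s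
    using that n by (simp add: field_simps)
  then have "2 * pi * t / n = 2 * pi * t' / n" using arg eq t by metis
  then show ?thesis using n by simp
qed

context triangle_complex
begin

lemma cell_expand:
  assumes f: "f \<in> K" and x: "x \<in> cell f"
  shows "x = (\<Sum>u\<in>range f. (x \<bullet> e u) *\<^sub>R e u)" "(\<Sum>u\<in>range f. x \<bullet> e u) = 1"
proof -
  obtain b where b: "b \<in> std_triangle" "x = char_map e f b" using x by (auto simp: cell_def)
  show "x = (\<Sum>u\<in>range f. (x \<bullet> e u) *\<^sub>R e u)"
    using f b(2) by (simp add: sum_over_range char_map_coord) (simp add: char_map_def)
  show "(\<Sum>u\<in>range f. x \<bullet> e u) = 1"
    using f b by (simp add: sum_over_range char_map_coord std_triangle_def)
qed

lemma in_cell_if_coord_pos: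
  assumes "x \<in> polyhedron" "v \<in> W" "0 < x \<bullet> e v"
  obtains f where "f \<in> K" "v \<in> range f" "x \<in> cell f"
proof -
  obtain f b where f: "f \<in> K" "b \<in> std_triangle" "x = char_map e f b"
    using assms(1) by (auto simp: mem_polyhedron_iff)
  then have "v \<in> range f" using char_map_coord_0[OF f(1) assms(2)] assms(3) by force
  then show thesis using f that by (auto simp: cell_def)
qed

end

locale vertex_star = triangle_complex K e W + link_cycle K v n w
  for K :: "(3 \<Rightarrow> 'v) set" and e :: "'v \<Rightarrow> 'b::euclidean_space" and W v n w +
  assumes vW: "v \<in> W"
begin

text \<open>The closed polygon that runs through the link, covering one edge per unit of time.\<close>

definition loop :: "real \<Rightarrow> 'b" where
  "loop t = (\<Sum>k\<le>n. hat t k *\<^sub>R e (w k))"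

lemma w_in_W: "i \<le> n \<Longrightarrow> w i \<in> W"
proof -
  have *: "w i \<in> W" if i: "i < n" for i
  proof -
    obtain f where "f \<in> K" "range f = {v, w i, w (Suc i)}" using link_triangle[OF i] .
    then show ?thesis unfolding W_eq by blast
  qed
  assume "i \<le> n"
  then show ?thesis using *[of i] *[of 0] three closed_w by (cases "i = n") auto
qed

lemma loop_on_edge:
  assumes "i < n" "real i \<le> t" "t \<le> real (Suc i)"
  shows "loop t = (1 - (t - i)) *\<^sub>R e (w i) + (t - i) *\<^sub>R e (w (Suc i))"
proof -
  have "loop t = (\<Sum>k\<in>{i, Suc i}. hat t k *\<^sub>R e (w k))"
    unfolding loop_def using assms
    by (intro sum.mono_neutral_right) (auto simp: hat_at[of i])
  then show ?thesis using assms by (simp add: hat_at[of i])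
qed

lemma edge_of_parameter:
  assumes "0 \<le> t" "t \<le> real n"
  obtains i where "i < n" "real i \<le> t" "t \<le> real (Suc i)" "t < real n \<Longrightarrow> t < real (Suc i)"
proof (cases "t = real n")
  case True
  then show thesis using that[of "n - 1"] three by (simp add: of_nat_diff)
next
  case False
  then have "t < real n" using assms by simp
  then show thesis
    using assms that[of "nat \<lfloor>t\<rfloor>"] by (simp add: nat_less_iff floor_less_iff) linarith
qed

lemma loop_inner_v: "0 \<le> t \<Longrightarrow> t \<le> real n \<Longrightarrow> loop t \<bullet> e v = 0"
  unfolding loop_def inner_sum_left
  by (intro sum.neutral) (auto simp: orthonormal w_in_W vW w_neq_v)

lemma loop_closed: "loop (real n) = loop 0"
proof -
  have "loop (real n) = e (w n)" using loop_on_edge[of "n - 1" "real n"] three by (simp add: of_nat_diff)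
  moreover have "loop 0 = e (w 0)" using loop_on_edge[of 0 0] three by simp
  ultimately show ?thesis by (simp add: closed_w)
qed

lemma loop_inj:
  assumes t: "0 \<le> t" "t < real n" and t': "0 \<le> t'" "t' < real n" and eq: "loop t = loop t'"
  shows "t = t'"
proof -
  obtain i where i: "i < n" "real i \<le> t" "t < real (Suc i)"
    using edge_of_parameter[of t] t by (metis less_le)
  obtain j where j: "j < n" "real j \<le> t'" "t' < real (Suc j)"
    using edge_of_parameter[of t'] t' by (metis less_le)
  have coord: "loop t \<bullet> e u = (if u = w i then 1 - (t - i) else if u = w (Suc i) then t - i else 0)"
    if "u \<in> W" "i < n" "real i \<le> t" "t < real (Suc i)" for u i t
  proof -
    have ne: "w i \<noteq> w (Suc i)" using w_eq_iff[of i "Suc i"] that(2) three by auto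
    have W: "w i \<in> W" "w (Suc i) \<in> W" using that(2) w_in_W by auto
    have "loop t \<bullet> e u = (1 - (t - i)) * (e (w i) \<bullet> e u) + (t - i) * (e (w (Suc i)) \<bullet> e u)"
      using loop_on_edge[of i t] that by (simp add: inner_add_left)
    then show ?thesis using ne that(1) W by (simp add: orthonormal)
  qed
  have W: "w i \<in> W" "w j \<in> W" using i j w_in_W by auto
  have "w i = w j"
  proof (rule ccontr)
    assume ne: "w i \<noteq> w j"
    have "w i = w (Suc j)"
      using coord[OF W(1) i] coord[OF W(1) j] eq ne i(3) by (auto split: if_splits)
    moreover have "w j = w (Suc i)"
      using coord[OF W(2) i] coord[OF W(2) j] eq ne j(3) by (auto split: if_splits)
    ultimately have "{w i, w (Suc i)} = {w j, w (Suc j)}" by auto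
    then show False using consecutive_inj i(1) j(1) ne by blast
  qed
  then have "i = j" using w_eq_iff[of i j] i j by auto
  have "loop t \<bullet> e (w i) = 1 - (t - i)" using coord[OF W(1) i] by (simp only: simp_thms if_True)
  moreover have "loop t' \<bullet> e (w j) = 1 - (t' - j)" using coord[OF W(2) j] by (simp only: simp_thms if_True)
  ultimately have "1 - (t - i) = 1 - (t' - i)" using eq \<open>i = j\<close> by metis
  then show ?thesis by simp
qed

text \<open>Polar coordinates \<open>(s, t)\<close>, with \<open>n\<close> units of angle in a full turn, on the plane and on the
  star. Both maps identify the same points of the rectangle.\<close>

definition polar_plane :: "real \<times> real \<Rightarrow> complex" where
  "polar_plane p = of_real (fst p) * cis (2 * pi * snd p / n)"

definition polar_star :: "real \<times> real \<Rightarrow> 'b" where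
  "polar_star p = (1 - fst p) *\<^sub>R e v + fst p *\<^sub>R loop (snd p)"

definition rectangle :: "(real \<times> real) set" where
  "rectangle = {0..1} \<times> {0..real n}"

definition closed_star :: "'b set" where
  "closed_star = (\<Union>f\<in>{f \<in> K. v \<in> range f}. cell f)"

definition open_star :: "'b set" where
  "open_star = {x \<in> polyhedron. 0 < x \<bullet> e v}"

lemma polar_star_inner_v: "p \<in> rectangle \<Longrightarrow> polar_star p \<bullet> e v = 1 - fst p"
  using orthonormal[OF vW vW]
  by (auto simp: polar_star_def rectangle_def inner_add_left loop_inner_v)

lemma norm_polar_plane: "p \<in> rectangle \<Longrightarrow> norm (polar_plane p) = fst p"
  by (auto simp: polar_plane_def rectangle_def norm_mult)

lemma same_fibres:
  assumes p: "p \<in> rectangle" and q: "q \<in> rectangle"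
  shows "polar_star p = polar_star q \<longleftrightarrow> polar_plane p = polar_plane q"
proof (cases "fst p = fst q \<and> fst p \<noteq> 0")
  case True
  have n: "0 < real n" using three by simp
  \<comment> \<open>The parameters \<open>0\<close> and \<open>n\<close> give the same direction, so \<open>n\<close> is replaced by \<open>0\<close>.\<close>
  define r where "r = (\<lambda>t::real. if t = real n then 0 else t)"
  have r: "0 \<le> r (snd p)" "r (snd p) < real n" "0 \<le> r (snd q)" "r (snd q) < real n"
    using p q n by (auto simp: r_def rectangle_def)
  have loop_r: "loop (r t) = loop t" for t by (simp add: r_def loop_closed)
  have cis_r: "cis (2 * pi * r t / n) = cis (2 * pi * t / n)" for t using n by (simp add: r_def)
  have "polar_star p = polar_star q \<longleftrightarrow> loop (r (snd p)) = loop (r (snd q))"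
    using True by (simp add: polar_star_def loop_r)
  also have "\<dots> \<longleftrightarrow> r (snd p) = r (snd q)" using loop_inj[OF r] by auto
  also have "\<dots> \<longleftrightarrow> cis (2 * pi * r (snd p) / n) = cis (2 * pi * r (snd q) / n)"
    using cis_inj_period[OF n r] by auto
  also have "\<dots> \<longleftrightarrow> polar_plane p = polar_plane q"
    using True by (simp add: polar_plane_def cis_r)
  finally show ?thesis .
next
  case False
  show ?thesis
  proof (cases "fst p = fst q")
    case True
    then show ?thesis using False by (simp add: polar_star_def polar_plane_def)
  next
    case ne: False
    then show ?thesis
      using polar_star_inner_v[OF p] polar_star_inner_v[OF q] norm_polar_plane[OF p] norm_polar_plane[OF q]
      by auto
  qed
qed

lemma polar_plane_image: "polar_plane ` rectangle = cball 0 1"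
proof
  show "polar_plane ` rectangle \<subseteq> cball 0 1"
    using norm_polar_plane by (auto simp: rectangle_def)
  show "cball 0 1 \<subseteq> polar_plane ` rectangle"
  proof
    fix z :: complex assume "z \<in> cball 0 1"
    moreover have n: "0 < real n" using three by simp
    moreover have "real n * Arg2pi z \<le> real n * (2 * pi)"
      using Arg2pi_lt_2pi[of z] n by (intro mult_left_mono) auto
    ultimately have "(norm z, n * Arg2pi z / (2 * pi)) \<in> rectangle"
      using Arg2pi_ge_0[of z] by (simp add: rectangle_def field_simps)
    moreover have "polar_plane (norm z, n * Arg2pi z / (2 * pi)) = z"
      using Arg2pi_eq[of z] n by (simp add: polar_plane_def cis_conv_exp)
    ultimately show "z \<in> polar_plane ` rectangle" by (metis imageI)
  qed
qed

lemma polar_star_image: "polar_star ` rectangle = closed_star"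
proof
  show "polar_star ` rectangle \<subseteq> closed_star"
  proof
    fix x assume "x \<in> polar_star ` rectangle"
    then obtain s t where st: "0 \<le> s" "s \<le> 1" "0 \<le> t" "t \<le> real n" "x = polar_star (s, t)"
      by (auto simp: rectangle_def)
    obtain i where i: "i < n" "real i \<le> t" "t \<le> real (Suc i)"
      using edge_of_parameter st by metis
    obtain f where f: "f \<in> K" "range f = {v, w i, w (Suc i)}" using link_triangle[OF i(1)] .
    have vert: "e u \<in> cell f" if "u \<in> {v, w i, w (Suc i)}" for u
      using vertex_in_cell[where f = f] that unfolding f(2)[symmetric] by blast
    have "loop t \<in> cell f"
      unfolding loop_on_edge[OF i] using i vert by (intro convexD[OF convex_cell]) auto
    then have "x \<in> cell f"
      unfolding st(5) polar_star_def using st vert by (auto intro!: convexD[OF convex_cell])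
    then show "x \<in> closed_star" using f by (auto simp: closed_star_def)
  qed
  show "closed_star \<subseteq> polar_star ` rectangle"
  proof
    fix x assume "x \<in> closed_star"
    then obtain f where f: "f \<in> K" "v \<in> range f" and x: "x \<in> cell f" by (auto simp: closed_star_def)
    obtain i where i: "i < n" "range f = {v, w i, w (Suc i)}" using link_triangle_cases[OF f] .
    have W: "w i \<in> W" "w (Suc i) \<in> W" using i(1) w_in_W by auto
    have ne: "v \<noteq> w i" "v \<noteq> w (Suc i)" "w i \<noteq> w (Suc i)"
      using w_neq_v[of i] w_neq_v[of "Suc i"] w_eq_iff[of i "Suc i"] i(1) three by auto
    define b c where "b = x \<bullet> e (w i)" and "c = x \<bullet> e (w (Suc i))"
    have bc: "0 \<le> b" "0 \<le> c" "0 \<le> x \<bullet> e v"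
      using coord_nonneg[of x] x f(1) W vW cell_subset by (auto simp: b_def c_def)
    have sum: "x \<bullet> e v + b + c = 1"
      using cell_expand(2)[OF f(1) x] ne by (simp add: i(2) b_def c_def add.assoc)
    have xeq: "x = (x \<bullet> e v) *\<^sub>R e v + b *\<^sub>R e (w i) + c *\<^sub>R e (w (Suc i))"
      using cell_expand(1)[OF f(1) x] ne by (simp add: i(2) b_def c_def add.assoc)
    define s where "s = b + c"
    have s: "0 \<le> s" "s \<le> 1" "x \<bullet> e v = 1 - s" using bc sum by (auto simp: s_def)
    show "x \<in> polar_star ` rectangle"
    proof (cases "s = 0")
      case True
      then have "b = 0" "c = 0" using bc by (auto simp: s_def)
      then have "x = polar_star (0, 0)" using xeq s True by (simp add: polar_star_def)
      moreover have "(0, 0) \<in> rectangle" by (simp add: rectangle_def)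
      ultimately show ?thesis by blast
    next
      case False
      then have sp: "s > 0" using s by simp
      define t where "t = real i + c / s"
      have t: "real i \<le> t" "t \<le> real (Suc i)" using sp bc by (auto simp: t_def s_def field_simps)
      have "1 - (t - i) = b / s" "t - i = c / s" using sp by (auto simp: t_def s_def field_simps)
      then have "s *\<^sub>R loop t = b *\<^sub>R e (w i) + c *\<^sub>R e (w (Suc i))"
        using sp by (simp add: loop_on_edge[OF i(1) t] scaleR_add_right)
      then have "x = polar_star (s, t)" using xeq s by (simp add: polar_star_def add.assoc)
      moreover have "(s, t) \<in> rectangle" using s t i(1) by (auto simp: rectangle_def)
      ultimately show ?thesis by blast
    qed
  qed
qed

text \<open>Both polar coordinate maps are continuous surjections from a compact rectangle, hence quotient
  maps; having the same fibres, they induce a homeomorphism of the closed disc with the closed star.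
  It turns the norm into one minus the coordinate of \<open>v\<close>, so that the open disc corresponds to the open
  star.\<close>

lemma open_star_homeomorphic_ball: "top_of_set open_star homeomorphic_space top_of_set (ball (0::complex) 1)"
proof -
  define G where "G = polar_star \<circ> inv_into rectangle polar_plane"
  have G: "G (polar_plane p) = polar_star p" if p: "p \<in> rectangle" for p
  proof -
    have "inv_into rectangle polar_plane (polar_plane p) \<in> rectangle"
      "polar_plane (inv_into rectangle polar_plane (polar_plane p)) = polar_plane p"
      using p by (auto intro: inv_into_into f_inv_into_f)
    then show ?thesis using same_fibres[OF _ p] by (simp add: G_def)
  qed
  have "compact rectangle" unfolding rectangle_def by (intro compact_Times) auto
  moreover have cont_plane: "continuous_on rectangle polar_plane"
    unfolding polar_plane_def cis_conv_exp using three by (intro continuous_intros) auto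
  ultimately have quot: "quotient_map (top_of_set rectangle) (top_of_set (cball 0 1)) polar_plane"
    using polar_plane_image
    by (intro continuous_imp_quotient_map)
       (auto simp: continuous_map_subtopology_eu compact_space_subtopology Hausdorff_space_subtopology)
  have "continuous_on rectangle polar_star"
    unfolding polar_star_def loop_def hat_def by (intro continuous_intros)
  then have "continuous_map (top_of_set rectangle) euclidean (G \<circ> polar_plane)"
    using G by (auto cong: continuous_on_cong)
  then have contG: "continuous_on (cball 0 1) G"
    using continuous_compose_quotient_map[OF quot, of euclidean G] by simp
  have imG: "G ` cball 0 1 = closed_star"
    unfolding polar_plane_image[symmetric] polar_star_image[symmetric] image_image using G by simp
  have "inj_on G (cball 0 1)"
    unfolding polar_plane_image[symmetric]
    by (rule inj_onI) (auto simp: G same_fibres)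
  then obtain g where hom: "homeomorphism (cball 0 1) closed_star G g"
    using homeomorphism_compact[OF compact_cball contG imG] by blast
  have Gv: "G z \<bullet> e v = 1 - norm z" if z: "z \<in> cball 0 1" for z
  proof -
    obtain p where "p \<in> rectangle" "z = polar_plane p"
      using z unfolding polar_plane_image[symmetric] by (rule imageE)
    then show ?thesis using G polar_star_inner_v norm_polar_plane by simp
  qed
  have sub: "open_star \<subseteq> closed_star"
  proof
    fix x assume "x \<in> open_star"
    then have x: "x \<in> polyhedron" "0 < x \<bullet> e v" by (simp_all add: open_star_def)
    obtain f where "f \<in> K" "v \<in> range f" "x \<in> cell f"
      by (rule in_cell_if_coord_pos[OF x(1) vW x(2)])
    then show "x \<in> closed_star" by (auto simp: closed_star_def)
  qed
  have "G ` ball 0 1 = {x \<in> closed_star. 0 < x \<bullet> e v}"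
    unfolding imG[symmetric] using Gv by (auto simp: image_iff)
  also have "\<dots> = open_star"
  proof -
    have "closed_star \<subseteq> polyhedron" using cell_subset by (auto simp: closed_star_def)
    then show ?thesis using sub unfolding open_star_def by blast
  qed
  finally have "homeomorphism (ball 0 1) open_star G g"
    using homeomorphism_of_subsets[OF hom] by (metis ball_subset_cball subset_refl)
  then show ?thesis using homeomorphism_imp_homeomorphic_space homeomorphic_space_sym by blast
qed

end

context triangle_complex
begin

text \<open>The open stars cover, because the coordinates of a point are nonnegative and add up to one.\<close>

lemma closed_connected_surface_polyhedron: "closed_connected_surface (top_of_set polyhedron)"
  unfolding closed_connected_surface_def
proof (intro conjI ballI)
  show "topspace (top_of_set polyhedron) \<noteq> {}"
    using K_nonempty vertex_in_cell by (auto simp: polyhedron_def)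
  show "compact_space (top_of_set polyhedron)"
    using compact_polyhedron by (simp add: compact_space_subtopology)
  show "Hausdorff_space (top_of_set polyhedron)"
    by (simp add: Hausdorff_space_subtopology)
  have "path_connected polyhedron"
    unfolding path_connected_def
  proof (intro ballI)
    fix x y assume "x \<in> polyhedron" "y \<in> polyhedron"
    then obtain L where "joined_within polyhedron L x y" using polyhedron_joined by blast
    then obtain \<gamma> where \<gamma>: "0 \<le> L" "1-lipschitz_on {0..L} \<gamma>" "\<gamma> ` {0..L} \<subseteq> polyhedron" "\<gamma> 0 = x" "\<gamma> L = y"
      unfolding joined_within_def by (elim conjE exE)
    have "path (\<lambda>t. \<gamma> (L * t))"
      unfolding path_def using \<gamma>(1)
      by (intro continuous_on_compose2[OF lipschitz_on_continuous_on[OF \<gamma>(2)]] continuous_intros)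
         (auto simp: mult_left_le)
    moreover have "path_image (\<lambda>t. \<gamma> (L * t)) \<subseteq> polyhedron"
      using \<gamma>(1,3) by (auto simp: path_image_def image_subset_iff mult_left_le)
    ultimately show "\<exists>g. path g \<and> path_image g \<subseteq> polyhedron \<and> pathstart g = x \<and> pathfinish g = y"
      using \<gamma>(4,5) by (intro exI[of _ "\<lambda>t. \<gamma> (L * t)"]) (auto simp: pathstart_def pathfinish_def)
  qed
  then show "connected_space (top_of_set polyhedron)"
    using path_connected_imp_connected connectedin_iff_connected connectedin_def by metis
next
  fix x assume "x \<in> topspace (top_of_set polyhedron)"
  then have x: "x \<in> polyhedron" by simp
  obtain v where v: "v \<in> W" "0 < x \<bullet> e v"
    using sum_coords[OF x] coord_nonneg[OF x] sum_nonpos[of W "\<lambda>v. x \<bullet> e v"] by force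
  obtain n w where "link_cycle K v n w" using link_cycle_at[OF v(1)] .
  then interpret vertex_star K e W v n w
    using triangle_complex_axioms v(1) by (simp add: vertex_star_def vertex_star_axioms_def)
  have "open_star = polyhedron \<inter> {x. 0 < x \<bullet> e v}" by (auto simp: open_star_def)
  moreover have "open {x. 0 < x \<bullet> e v}" by (intro open_Collect_less continuous_intros)
  ultimately have "openin (top_of_set polyhedron) open_star" by (auto simp: openin_open)
  moreover have "x \<in> open_star" using x v by (simp add: open_star_def)
  moreover have "\<exists>V :: (real^2) set. open V \<and> 
      subtopology (top_of_set polyhedron) open_star homeomorphic_space top_of_set V"
  proof -
    obtain f :: "complex \<Rightarrow> real^2" and g where fg: "linear f" "linear g" "\<And>x. norm (f x) = norm x"
      "\<And>x. norm (g x) = norm x" "\<And>x. g (f x) = x" "\<And>y. f (g y) = y"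
      by (rule isomorphisms_UNIV_UNIV[where 'M = complex and 'N = "real^2"]) auto
    have "homeomorphism (ball 0 1) (ball 0 1) f g"
    proof (rule homeomorphismI)
      show "continuous_on (ball 0 1) f" "continuous_on (ball 0 1) g"
        using fg(1,2) by (simp_all add: linear_continuous_on linear_conv_bounded_linear)
    qed (use fg in auto)
    then have "top_of_set (ball (0::complex) 1) homeomorphic_space top_of_set (ball (0::real^2) 1)"
      by (rule homeomorphism_imp_homeomorphic_space)
    moreover have "subtopology (top_of_set polyhedron) open_star = top_of_set open_star"
      by (simp add: subtopology_subtopology open_star_def Int_absorb1 subset_iff)
    ultimately show ?thesis
      using open_star_homeomorphic_ball homeomorphic_space_trans open_ball by metis
  qed
  ultimately show "\<exists>U V. openin (top_of_set polyhedron) U \<and> x \<in> U \<and> open (V :: (real^2) set) \<and>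
      subtopology (top_of_set polyhedron) U homeomorphic_space top_of_set V" by blast
qed

end

section \<open>A triangulated surface of 17 vertices that violates condition (B)\<close>

text \<open>The cyclic triangulation of a closed surface with all the edges of the complete graph on the
  residues modulo 13. It consists of the translates of \<open>{0, 1, 2}\<close>, \<open>{0, 2, 6}\<close>, \<open>{0, 3, 7}\<close> and
  \<open>{0, 3, 8}\<close>: the gaps of an increasing triple \<open>a < b < c\<close> are two consecutive ones among the cyclic
  gaps \<open>(1, 1, 11)\<close>, \<open>(2, 4, 7)\<close>, \<open>(3, 4, 6)\<close> and \<open>(3, 5, 5)\<close>.\<close>

definition hub_gaps :: "(nat \<times> nat) list" where
  "hub_gaps = [(1, 1), (1, 11), (11, 1), (2, 4), (4, 7), (7, 2), (3, 4), (4, 6), (6, 3), (3, 5), (5, 5), (5, 3)]"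

definition hub_triples :: "(nat \<times> nat \<times> nat) list" where
  "hub_triples = [(a, b, c). a \<leftarrow> [0..<13], b \<leftarrow> [Suc a..<13], c \<leftarrow> [Suc b..<13],
     (b - a, c - b) \<in> set hub_gaps]"

text \<open>The torus with 7 vertices consists of the translates of \<open>{0, 1, 3}\<close> and \<open>{0, 2, 3}\<close> modulo 7. Its
  vertices \<open>0, \<dots>, 6\<close> are renamed to \<open>10, 11, 13, 12, 14, 15, 16\<close>, and \<open>{10, 11, 12}\<close>, the renamed
  \<open>{0, 1, 3}\<close>, is left out.\<close>

definition torus_triples :: "(nat \<times> nat \<times> nat) list" where
  "torus_triples =
    [(10, 11, 15), (10, 12, 13), (10, 13, 16), (10, 14, 15), (10, 14, 16), (11, 12, 14), (11, 13, 14),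
     (11, 13, 16), (11, 15, 16), (12, 13, 15), (12, 14, 16), (12, 15, 16), (13, 14, 15)]"

text \<open>The connected sum along \<open>{10, 11, 12}\<close>.\<close>

definition sum_triples :: "(nat \<times> nat \<times> nat) list" where
  "sum_triples = filter (\<lambda>t. t \<noteq> (10, 11, 12)) hub_triples @ torus_triples"

text \<open>The entry with index \<open>v\<close> lists the neighbours of \<open>v\<close> in cyclic order. At \<open>10\<close>, \<open>11\<close> and \<open>12\<close> the
  cycles of both summands are joined.\<close>

definition link_table :: "nat list list" where
  "link_table =
    [[1, 2, 6, 9, 7, 3, 8, 5, 10, 4, 11, 12],
     [0, 2, 3, 7, 10, 8, 4, 9, 6, 11, 5, 12],
     [0, 1, 3, 4, 8, 11, 9, 5, 10, 7, 12, 6],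
     [0, 7, 1, 2, 4, 5, 9, 12, 10, 6, 11, 8],
     [0, 10, 6, 5, 3, 2, 8, 1, 9, 12, 7, 11],
     [0, 8, 12, 1, 11, 7, 6, 4, 3, 9, 2, 10],
     [0, 2, 12, 8, 7, 5, 4, 10, 3, 11, 1, 9],
     [0, 3, 1, 10, 2, 12, 4, 11, 5, 6, 8, 9],
     [0, 3, 11, 2, 4, 1, 10, 9, 7, 6, 12, 5],
     [0, 6, 1, 4, 12, 3, 5, 2, 11, 10, 8, 7],
     [0, 4, 6, 3, 12, 13, 16, 14, 15, 11, 9, 8, 1, 7, 2, 5],
     [0, 4, 7, 5, 1, 6, 3, 8, 2, 9, 10, 15, 16, 13, 14, 12],
     [0, 1, 5, 8, 6, 2, 7, 4, 9, 3, 10, 13, 15, 16, 14, 11],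
     [10, 12, 15, 14, 11, 16],
     [10, 15, 13, 11, 12, 16],
     [10, 14, 13, 12, 16, 11],
     [10, 14, 12, 15, 11, 13]]"

lemma triples_ordered: "list_all (\<lambda>(a, b, c). a < b \<and> b < c \<and> c < 17) sum_triples"
  by code_simp

lemma triples_distinct: "distinct sum_triples"
  by code_simp

lemma triples_length: "length sum_triples = 64"
  by code_simp

text \<open>A triangle meets \<open>{13, \<dots>, 16}\<close> just if its largest vertex does.\<close>

lemma triples_meeting: "length (filter (\<lambda>(a, b, c). 13 \<le> c) sum_triples) = 13"
  by code_simp

lemma links_distinct: "list_all (\<lambda>xs. distinct xs \<and> 6 \<le> length xs) link_table"
  by code_simp

lemma links_correct: "list_all (\<lambda>(v, xs). 
   (\<lambda>(a, b, c). {a, b, c}) ` set (filter (\<lambda>(a, b, c). v \<in> {a, b, c}) sum_triples) =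
   (\<lambda>(a, b). {v, a, b}) ` set (zip xs (rotate1 xs))) (zip [0..<17] link_table)"
  by code_simp

text \<open>A common vertex of both summands; that it is adjacent to all the others makes the sum connected.\<close>

lemma apex_adjacent_to_all: "list_all (\<lambda>v. v = 10 \<or> v \<in> set (link_table ! 10)) [0..<17]"
  by code_simp

definition corner_labels :: "nat \<times> nat \<times> nat \<Rightarrow> 3 \<Rightarrow> nat" where
  "corner_labels = (\<lambda>(a, b, c) i. if i = 1 then a else if i = 2 then b else c)"

definition sum_complex :: "(3 \<Rightarrow> nat) set" where
  "sum_complex = corner_labels ` set sum_triples"

lemma range_corner_labels: "range (corner_labels (a, b, c)) = {a, b, c}"
proof -
  have "range (corner_labels (a, b, c)) = corner_labels (a, b, c) ` {1, 2, 3}" by (simp only: UNIV_3)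
  also have "\<dots> = {a, b, c}" by (auto simp: corner_labels_def)
  finally show ?thesis .
qed

lemma sum_triple_ordered: "(a, b, c) \<in> set sum_triples \<Longrightarrow> a < b \<and> b < c \<and> c < 17"
  using triples_ordered by (auto simp: list_all_iff)

lemma corner_labels_eq_if_same_range:
  assumes "s \<in> set sum_triples" "t \<in> set sum_triples"
    and "range (corner_labels s) = range (corner_labels t)"
  shows "s = t"
proof -
  obtain a b c where s: "s = (a, b, c)" by (cases s)
  obtain a' b' c' where t: "t = (a', b', c')" by (cases t)
  have "a < b" "b < c" "a' < b'" "b' < c'" using sum_triple_ordered assms(1,2) s t by auto
  moreover have "{a, b, c} = {a', b', c'}" using assms(3) by (simp add: s t range_corner_labels)
  then have "a \<in> {a', b', c'}" "b \<in> {a', b', c'}" "c \<in> {a', b', c'}"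
    "a' \<in> {a, b, c}" "b' \<in> {a, b, c}" "c' \<in> {a, b, c}" by blast+
  ultimately show ?thesis by (auto simp: s t)
qed

lemma sum_complex_filter:
  "{f \<in> sum_complex. P (range f)} = corner_labels ` set (filter (\<lambda>(a, b, c). P {a, b, c}) sum_triples)"
  by (auto simp: sum_complex_def range_corner_labels)

lemma card_sum_complex_filter:
  "card {f \<in> sum_complex. P (range f)} = length (filter (\<lambda>(a, b, c). P {a, b, c}) sum_triples)"
proof -
  let ?L = "filter (\<lambda>(a, b, c). P {a, b, c}) sum_triples"
  have "inj_on corner_labels (set ?L)"
    by (rule inj_onI) (auto dest: corner_labels_eq_if_same_range)
  then have "card {f \<in> sum_complex. P (range f)} = card (set ?L)"
    unfolding sum_complex_filter by (rule card_image)
  also have "\<dots> = length ?L" using triples_distinct by (intro distinct_card) simp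
  finally show ?thesis .
qed

lemma link_at:
  assumes "v < 17"
  shows "is_link sum_complex v (link_table ! v) \<and> 6 \<le> length (link_table ! v)"
proof -
  have len: "length link_table = 17" by (simp add: link_table_def)
  then have "link_table ! v \<in> set link_table" using assms by simp
  then have "distinct (link_table ! v)" "6 \<le> length (link_table ! v)"
    using links_distinct by (auto simp: list_all_iff)
  moreover have "(v, link_table ! v) \<in> set (zip [0..<17] link_table)"
    using assms len by (auto simp: set_zip intro!: exI[of _ v])
  from bspec[OF links_correct[unfolded list_all_iff] this]
  have "(\<lambda>(a, b, c). {a, b, c}) ` set (filter (\<lambda>(a, b, c). v \<in> {a, b, c}) sum_triples) =
      (\<lambda>(a, b). {v, a, b}) ` set (zip (link_table ! v) (rotate1 (link_table ! v)))"
    unfolding prod.case .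
  moreover have "range ` {f \<in> sum_complex. v \<in> range f} =
      (\<lambda>(a, b, c). {a, b, c}) ` set (filter (\<lambda>(a, b, c). v \<in> {a, b, c}) sum_triples)"
  proof -
    have "range ` corner_labels ` set L = (\<lambda>(a, b, c). {a, b, c}) ` set L" for L
      unfolding image_image by (intro image_cong) (simp_all add: range_corner_labels split: prod.split)
    then show ?thesis unfolding sum_complex_filter[of "\<lambda>D. v \<in> D"] .
  qed
  ultimately show ?thesis by (simp add: is_link_def)
qed

lemma triangle_complex_sum:
  assumes orth: "\<And>v w. v < 17 \<Longrightarrow> w < 17 \<Longrightarrow> e v \<bullet> e w = of_bool (v = w)"
  shows "triangle_complex sum_complex (e :: nat \<Rightarrow> 'b::euclidean_space) {..<17}"
proof
  show "finite sum_complex" "sum_complex \<noteq> {}"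
    using triples_length by (auto simp: sum_complex_def)
  have sub: "range f \<subseteq> {..<17}" if f: "f \<in> sum_complex" for f
  proof -
    obtain a b c where "(a, b, c) \<in> set sum_triples" "f = corner_labels (a, b, c)"
      using f by (auto simp: sum_complex_def)
    then show ?thesis using sum_triple_ordered[of a b c] by (simp add: range_corner_labels)
  qed
  show inj: "inj f" if f: "f \<in> sum_complex" for f
  proof -
    obtain a b c where abc: "(a, b, c) \<in> set sum_triples" "f = corner_labels (a, b, c)"
      using f by (auto simp: sum_complex_def)
    then have "card (range f) = 3" using sum_triple_ordered[of a b c] by (simp add: range_corner_labels)
    then show ?thesis by (intro eq_card_imp_inj_on) auto
  qed
  show "f = g" if fg: "f \<in> sum_complex" "g \<in> sum_complex" "range f = range g" for f g
  proof -
    obtain s where s: "s \<in> set sum_triples" "f = corner_labels s"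
      using fg(1) unfolding sum_complex_def by (elim imageE)
    obtain t where t: "t \<in> set sum_triples" "g = corner_labels t"
      using fg(2) unfolding sum_complex_def by (elim imageE)
    have "s = t" using corner_labels_eq_if_same_range[OF s(1) t(1)] fg(3) unfolding s(2) t(2) .
    then show ?thesis using s t by simp
  qed
  have is_link: "\<exists>xs. is_link sum_complex v xs" if "v < 17" for v using link_at[OF that] by blast
  then show "\<exists>xs. is_link sum_complex v xs" if "v \<in> {..<17}" for v using that by simp
  have cycle: "link_cycle sum_complex v (length (link_table ! v))
      (\<lambda>i. link_table ! v ! (i mod length (link_table ! v)))" if v: "v < 17" for v
    using link_at[OF v] inj by (intro link_cycle_if_is_link) auto
  have "\<exists>f\<in>sum_complex. v \<in> range f" if v: "v < 17" for v
  proof -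
    have "0 < length (link_table ! v)" using link_at[OF v] by linarith
    then obtain f where "f \<in> sum_complex" "range f = {v, link_table ! v ! (0 mod length (link_table ! v)),
        link_table ! v ! (Suc 0 mod length (link_table ! v))}"
      by (rule link_cycle.link_triangle[OF cycle[OF v]])
    then show ?thesis by blast
  qed
  then show "{..<17} = (\<Union>f\<in>sum_complex. range f)" using sub by blast
  let ?adj = "{(v, w). \<exists>f\<in>sum_complex. v \<in> range f \<and> w \<in> range f}"
  have apex: "(10, v) \<in> ?adj\<^sup>* \<and> (v, 10) \<in> ?adj\<^sup>*" if v: "v < 17" for v
  proof (cases "v = 10")
    case False
    then have "v \<in> set (link_table ! 10)"
      using apex_adjacent_to_all v by (auto simp: list_all_iff)
    then obtain i where i: "i < length (link_table ! 10)" "v = link_table ! 10 ! i"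
      by (auto simp: in_set_conv_nth)
    have "(10::nat) < 17" by simp
    from link_cycle.link_triangle[OF cycle[OF this] i(1)]
    obtain f where "f \<in> sum_complex" "10 \<in> range f" "v \<in> range f"
      using i by (metis insertCI mod_less)
    then have "(10, v) \<in> ?adj" "(v, 10) \<in> ?adj" by auto
    then show ?thesis by (meson r_into_rtrancl)
  qed simp
  fix v w :: nat assume "v \<in> {..<17}" "w \<in> {..<17}"
  then have "(v, 10) \<in> ?adj\<^sup>*" "(10, w) \<in> ?adj\<^sup>*"
    unfolding lessThan_iff using apex by blast+
  then show "(v, w) \<in> ?adj\<^sup>*" by (rule rtrancl_trans)
qed (use orth in auto)

lemma exists_delaunay_violating_condition_B:
  "\<exists>(m :: (nat \<Rightarrow> real) metric) T.
     closed_metric_surface m \<and> delaunay m T \<and> simplicial T \<and>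
     (\<forall>v\<in>verts T. vdegree T v > 5) \<and> \<not> condition_B T"
proof -
  obtain \<iota> :: "nat \<Rightarrow> 17" where \<iota>: "bij_betw \<iota> {..<17} UNIV"
    using ex_bij_betw_nat_finite[of "UNIV :: 17 set"] by (auto simp: atLeast0LessThan)
  define e :: "nat \<Rightarrow> real^17" where "e k = axis (\<iota> k) 1" for k
  define h :: "real^17 \<Rightarrow> nat \<Rightarrow> real" where "h x k = x $ \<iota> k" for x k
  have "e v \<bullet> e w = of_bool (v = w)" if "v < 17" "w < 17" for v w
    using \<iota> that by (auto simp: e_def inner_axis_axis bij_betw_def inj_on_def)
  then interpret triangle_complex sum_complex e "{..<17}" by (rule triangle_complex_sum)
  have "inj h"
  proof (rule injI)
    fix x y assume "h x = h y"
    then have "x $ \<iota> k = y $ \<iota> k" for k by (metis h_def)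
    moreover have "range \<iota> = UNIV" using \<iota> by (auto simp: bij_betw_def)
    ultimately show "x = y" by (metis surjD vec_eq_iff)
  qed
  then interpret placed_complex sum_complex e "{..<17}" h
    by unfold_locales (rule inj_on_subset, auto)
  have "5 < vdegree realization v" if v: "v \<in> verts realization" for v
  proof -
    obtain k where "v = h (e k)" "k \<in> {..<17}"
      using v unfolding verts_realization by (rule imageE)
    then have k: "k < 17" "v = h (e k)" by simp_all
    have "vdegree realization v = card {f \<in> sum_complex. k \<in> range f}"
      unfolding k(2) using k(1) by (intro vdegree_realization) simp
    also have "\<dots> = length (link_table ! k)"
      using k(1) link_at[OF k(1)] by (intro card_triangles_at) simp_all
    finally show ?thesis using link_at[OF k(1)] by simp
  qed
  moreover have "\<not> condition_B realization"
  proof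
    let ?I = "(\<lambda>v. h (e v)) ` {13..<17}"
    assume B: "condition_B realization"
    have sub: "{13..<17} \<subseteq> {..<17::nat}"
      by (rule subsetI) (simp only: atLeastLessThan_iff lessThan_iff)
    have "?I \<subset> verts realization"
      unfolding verts_realization
    proof (rule image_strict_mono[OF inj_vertices])
      have "(0::nat) \<in> {..<17}" "(0::nat) \<notin> {13..<17}" by simp_all
      then show "{13..<17} \<subset> {..<17::nat}" using sub by blast
    qed
    then have "?I \<noteq> {} \<and> ?I \<subset> verts realization" by simp
    from B[unfolded condition_B_def, rule_format, OF this] have "real (card realization) / real (card (verts realization))
        < real (card (triangles_meeting realization ?I)) / real (card ?I)" .
    moreover have "card realization = 64"
      using card_sum_complex_filter[of "\<lambda>_. True"] triples_length by (simp add: card_realization)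
    moreover have "card (verts realization) = 17" by (simp add: card_verts_realization)
    moreover have "card ?I = 4"
      using card_image[OF inj_on_subset[OF inj_vertices sub]] by simp
    moreover have "card (triangles_meeting realization ?I) = 13"
    proof -
      have "card (triangles_meeting realization ?I) = card {f \<in> sum_complex. range f \<inter> {13..<17} \<noteq> {}}"
        by (rule card_triangles_meeting_realization[OF sub])
      also have "\<dots> = length (filter (\<lambda>(a, b, c). {a, b, c} \<inter> {13..<17} \<noteq> {}) sum_triples)"
        by (rule card_sum_complex_filter)
      also have "filter (\<lambda>(a, b, c). {a, b, c} \<inter> {13..<17} \<noteq> {}) sum_triples =
          filter (\<lambda>(a, b, c). 13 \<le> c) sum_triples"
        by (rule filter_cong) (auto dest!: sum_triple_ordered)
      finally show ?thesis by (simp add: triples_meeting)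
    qed
    ultimately show False by simp
  qed
  ultimately show ?thesis
    using closed_metric_surface_realization[OF closed_connected_surface_polyhedron]
      delaunay_realization simplicial_realization by blast
qed

theorem corollary3p1:
  shows "(\<forall>(m :: 'a metric) T.
            closed_metric_surface m \<and> delaunay m T \<and> (\<forall>v\<in>verts T. vdegree T v > 5) \<longrightarrow>
            condition_A (dual_voronoi T)) \<and>
         (\<exists>(m :: (nat \<Rightarrow> real) metric) T.
            closed_metric_surface m \<and> delaunay m T \<and> simplicial T \<and>
            (\<forall>v\<in>verts T. vdegree T v > 5) \<and> \<not> condition_B T) \<and>
         (\<forall>(m :: 'a metric) T.
            closed_metric_surface m \<and> delaunay m T \<and> (\<forall>v\<in>verts T. vdegree T v = 6) \<longrightarrow>
            condition_B T \<and> condition_A (dual_voronoi T))"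
proof (intro conjI)
  have tri: "triangulation (mtopology_of m) T" if "delaunay m T" for m :: "'a metric" and T
    using that by (simp add: delaunay_def geodesic_triangulation_def)
  have surf: "closed_connected_surface (mtopology_of m)" if "closed_metric_surface m" for m :: "'a metric"
    using that by (simp add: closed_metric_surface_def)
  show "\<forall>(m :: 'a metric) T.
      closed_metric_surface m \<and> delaunay m T \<and> (\<forall>v\<in>verts T. vdegree T v > 5) \<longrightarrow>
      condition_A (dual_voronoi T)"
    using condition_A_dual_voronoi tri surf by blast
  show "\<forall>(m :: 'a metric) T.
      closed_metric_surface m \<and> delaunay m T \<and> (\<forall>v\<in>verts T. vdegree T v = 6) \<longrightarrow>
      condition_B T \<and> condition_A (dual_voronoi T)"
    using condition_A_dual_voronoi condition_B_if_6_regular tri surf by blast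
qed (rule exists_delaunay_violating_condition_B)

end
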